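(* There exists a sequence $F=\{F_n\}_{n\in\mathbb{Z}}$ with $F_n\in\mathbb{D}$ for all $n$ and $F\in\ell^2(\mathbb{Z})$ such that, for every $z\in\mathbb{T}$, neither of the limits $\lim_{N\to\infty}\mathfrak{a}(z,F^{\langle N\rangle})$ and $\lim_{N\to\infty}\mathfrak{b}(z,F^{\langle N\rangle})$ exists.
   Context: $\mathbb{T}$ and $\mathbb{D}$ denote the unit circle and the open unit disc in $\mathbb{C}$. For a sequence $F=\{F_n\}_{n\in\mathbb{Z}}$ with $F_n\in\mathbb{D}$ and $N\in\mathbb{Z}^+$, the truncation is $F^{\langle N\rangle}_n=F_n\chi_{|n|\leqslant N}$. For a finitely supported sequence $G$ with values in $\mathbb{D}$ (the $SU(1,1)$ nonlinear Fourier transform on $\mathbb{Z}$): define $2\times2$ matrices $\widetilde X_n(z)$ by $\widetilde X_n=I$ for all $n$ below the support of $G$ and $\widetilde X_n=(1-|G_n|^2)^{-1/2}\begin{pmatrix}1&\overline{G_n}z^{-n}\\ G_nz^n&1\end{pmatrix}\widetilde X_{n-1}$. For $n$ above the support, $\widetilde X_n$ is constant and has the form $\begin{pmatrix}\mathfrak{a}(z,G)&\mathfrak{b}^{( * )}(z,G)\\ \mathfrak{b}(z,G)&\mathfrak{a}^{( * )}(z,G)\end{pmatrix}$, where $f^{( * )}(z):=\overline{f(\bar z^{-1})}$; this defines $\mathfrak{a}(z,G)$ and $\mathfrak{b}(z,G)$. *)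

theory Defs
  imports "HOL-Analysis.Analysis"
begin

definition mat2 :: "complex \<Rightarrow> complex \<Rightarrow> complex \<Rightarrow> complex \<Rightarrow> complex^2^2" where
  "mat2 a b c d = vector [vector [a, b], vector [c, d]]"

definition nlft_step :: "(int \<Rightarrow> complex) \<Rightarrow> complex \<Rightarrow> int \<Rightarrow> complex^2^2" where
  "nlft_step G z n =
     (1 / sqrt (1 - (norm (G n))\<^sup>2)) *\<^sub>R
     mat2 1 (cnj (G n) * z powi (- n)) (G n * z powi n) 1"

fun nlft_transfer :: "(int \<Rightarrow> complex) \<Rightarrow> complex \<Rightarrow> int \<Rightarrow> nat \<Rightarrow> complex^2^2" where
  "nlft_transfer G z lo 0 = mat 1"
| "nlft_transfer G z lo (Suc k) = nlft_step G z (lo + int k) ** nlft_transfer G z lo k"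

text \<open>For finitely supported G: pick M with support in [-M, M]; the final transfer
  matrix is the product over [-M, M] (factors outside the support are the identity).\<close>
definition supp_bound :: "(int \<Rightarrow> complex) \<Rightarrow> int" where
  "supp_bound G = (SOME M. 0 \<le> M \<and> (\<forall>n. G n \<noteq> 0 \<longrightarrow> \<bar>n\<bar> \<le> M))"

definition nlft_matrix :: "complex \<Rightarrow> (int \<Rightarrow> complex) \<Rightarrow> complex^2^2" where
  "nlft_matrix z G = nlft_transfer G z (- supp_bound G) (nat (2 * supp_bound G + 1))"

definition nlft_a :: "complex \<Rightarrow> (int \<Rightarrow> complex) \<Rightarrow> complex" where
  "nlft_a z G = nlft_matrix z G $ 1 $ 1"

definition nlft_b :: "complex \<Rightarrow> (int \<Rightarrow> complex) \<Rightarrow> complex" where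
  "nlft_b z G = nlft_matrix z G $ 2 $ 1"

definition trunc :: "(int \<Rightarrow> complex) \<Rightarrow> nat \<Rightarrow> int \<Rightarrow> complex" where
  "trunc F N n = (if \<bar>n\<bar> \<le> int N then F n else 0)"

end

theory Submission
  imports Defs
begin

text \<open>
  The nonlinear transform of a slowly swept chirp rotates the argument of \<open>\<aa>\<close> by an amount that
  is not controlled by the \<open>\<ell>\<^sup>2\<close> norm. Take \<open>2 * M\<close> terms of size
  \<open>\<epsilon>\<close> whose local frequency increases by \<open>2 * pi / M\<close> at each step, so that it sweeps
  the circle twice. At distance \<open>q\<close> from resonance with \<open>z\<close> the first-order response
  is \<open>\<epsilon> / q\<close>, which feeds back into \<open>\<aa>\<close> as a rotation by
  \<open>\<epsilon>\<^sup>2 / q\<close> per step. Summed over a sweep this is of order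
  \<open>\<epsilon>\<^sup>2 * M * ln M\<close>, whereas the \<open>\<ell>\<^sup>2\<close> norm squared is only
  \<open>2 * \<epsilon>\<^sup>2 * M\<close>, and the resonance itself contributes
  \<open>O(\<epsilon> * sqrt M)\<close> to \<open>\<bb>\<close>. With \<open>\<epsilon>\<^sup>2 = const / (M * ln M)\<close> the block has small
  norm and small \<open>\<bb>\<close>, yet for every \<open>z\<close> it moves \<open>\<aa>\<close> by a fixed amount at some
  intermediate time. Such blocks are concatenated after \<open>F 0 = 1 / 2\<close>, which keeps
  \<open>\<bb>\<close> away from zero, so that the rotations make both coefficients oscillate for every \<open>z\<close>.
\<close>

section \<open>Averaging for an oscillating linear system\<close>

lemma discrete_gronwall:
  fixes x a :: "nat \<Rightarrow> real"
  assumes a: "\<And>k. 0 \<le> a k" and c: "0 \<le> c"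
    and x: "\<And>n. n \<le> N \<Longrightarrow> x n \<le> c + (\<Sum>k<n. a k * x k)"
    and "n \<le> N"
  shows "x n \<le> c * exp (\<Sum>k<n. a k)"
proof -
  \<comment> \<open>The induction runs on the right-hand side of the hypothesis, since
    \<open>x\<close> itself satisfies no one-step recursion.\<close>
  have "c + (\<Sum>k<n. a k * x k) \<le> c * exp (\<Sum>k<n. a k)" if "n \<le> N" for n
    using that
  proof (induction n)
    case (Suc n)
    define s where "s = c + (\<Sum>k<n. a k * x k)"
    have "a n * x n \<le> a n * s"
      using x[of n] Suc.prems a[of n] by (intro mult_left_mono) (auto simp: s_def)
    then have "c + (\<Sum>k<Suc n. a k * x k) \<le> (1 + a n) * s"
      by (simp add: s_def algebra_simps)
    also have "\<dots> \<le> (1 + a n) * (c * exp (\<Sum>k<n. a k))"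
      using Suc a[of n] by (intro mult_left_mono) (auto simp: s_def)
    also have "\<dots> \<le> exp (a n) * (c * exp (\<Sum>k<n. a k))"
      using c by (intro mult_right_mono exp_ge_add_one_self) auto
    also have "\<dots> = c * exp (\<Sum>k<Suc n. a k)"
      by (simp add: exp_add)
    finally show ?case .
  qed auto
  with x[of n] \<open>n \<le> N\<close> show ?thesis by fastforce
qed

lemma summation_by_parts:
  fixes P Z :: "nat \<Rightarrow> 'a::comm_ring_1"
  assumes "m \<le> n"
  shows "(\<Sum>k=m..<n. (P (Suc k) - P k) * Z k) =
    P n * Z n - P m * Z m - (\<Sum>k=m..<n. P (Suc k) * (Z (Suc k) - Z k))"
  using assms by (induction n rule: dec_induct) (simp_all add: algebra_simps)

text \<open>\<open>P\<close> is an approximate antiderivative of \<open>w\<close>, with total defect at most \<open>E\<close>.\<close>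

locale unnormalised_system =
  fixes \<epsilon> :: real and w u v P :: "nat \<Rightarrow> complex" and A B E :: real and N :: nat
  assumes eps: "0 < \<epsilon>"
    and w: "\<And>k. norm (w k) = 1"
    and u0: "u 0 = 1" and v0: "v 0 = 0"
    and u_Suc: "\<And>k. u (Suc k) = u k + \<epsilon> * cnj (w k) * v k"
    and v_Suc: "\<And>k. v (Suc k) = v k + \<epsilon> * w k * u k"
    and u_le: "\<And>k. norm (u k) \<le> 1 + norm (v k)"
    and P_le: "\<And>k. k \<le> N \<Longrightarrow> norm (P k) \<le> A"
    and sum_P: "(\<Sum>k<N. norm (P (Suc k))) \<le> B"
    and sum_e: "(\<Sum>k<N. norm (w k - (P (Suc k) - P k))) \<le> E"
    and eps_A: "\<epsilon> * A \<le> 1/2"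
begin

definition e :: "nat \<Rightarrow> complex" where "e k = w k - (P (Suc k) - P k)"

text \<open>Subtracting the adiabatic response \<open>\<epsilon> * P k * u k\<close> leaves a quantity that varies slowly.\<close>

definition Z :: "nat \<Rightarrow> complex" where "Z k = v k - \<epsilon> * P k * u k"

text \<open>The first-order term \<open>\<epsilon> * w k * u k\<close> in the increment of
  \<open>v\<close> is cancelled by the increment of \<open>\<epsilon> * P k * u k\<close>, up to the
  defect \<open>e\<close> and a term of second order in \<epsilon>.\<close>

lemma Z_diff: "Z (Suc k) - Z k = \<epsilon> * e k * u k - \<epsilon>\<^sup>2 * P (Suc k) * cnj (w k) * v k"
  by (simp add: Z_def e_def u_Suc v_Suc algebra_simps power2_eq_square)

text \<open>Substituting \<open>v k = Z k + \<epsilon> * P k * u k\<close> splits the feedback: the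
  first term is the systematic rotation, the second an oscillation against the slow factor
  \<open>Z k\<close>.\<close>

lemma u_diff: "u (Suc k) - u k = \<epsilon>\<^sup>2 * (cnj (w k) * P k * u k) + \<epsilon> * (cnj (w k) * Z k)"
  by (simp add: Z_def u_Suc algebra_simps power2_eq_square)

lemma A_nonneg: "0 \<le> A"
  using P_le[of 0] norm_ge_zero order_trans by blast

lemma E_nonneg: "0 \<le> E"
  using sum_e sum_nonneg[of "{..<N}" "\<lambda>k. norm (w k - (P (Suc k) - P k))"] by auto

lemma norm_Z_diff:
  "norm (Z (Suc k) - Z k) \<le> \<epsilon> * norm (e k) * (1 + norm (v k)) + \<epsilon>\<^sup>2 * norm (P (Suc k)) * norm (v k)"
proof -
  have "norm (Z (Suc k) - Z k) \<le> norm (\<epsilon> * e k * u k) + norm (\<epsilon>\<^sup>2 * P (Suc k) * cnj (w k) * v k)"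
    unfolding Z_diff by (rule norm_triangle_ineq4)
  also have "\<dots> = \<epsilon> * norm (e k) * norm (u k) + \<epsilon>\<^sup>2 * norm (P (Suc k)) * norm (v k)"
    using eps w by (simp add: norm_mult norm_power)
  also have "\<dots> \<le> \<epsilon> * norm (e k) * (1 + norm (v k)) + \<epsilon>\<^sup>2 * norm (P (Suc k)) * norm (v k)"
    using eps u_le by (intro add_right_mono mult_left_mono) auto
  finally show ?thesis .
qed

text \<open>The Gronwall bound for \<open>v\<close>; \<open>W\<close> below is the resulting bound
  for \<open>Z\<close>.\<close>

definition V :: real where "V = 2 * (2 * (\<epsilon> * A) + \<epsilon> * E) * exp (2 * (\<epsilon> * E + \<epsilon>\<^sup>2 * B))"

lemma V_nonneg: "0 \<le> V"
  using eps A_nonneg E_nonneg by (simp add: V_def)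

lemma norm_v_le:
  assumes "n \<le> N"
  shows "norm (v n) \<le> V"
proof -
  \<comment> \<open>Half of \<open>norm (v n)\<close> is absorbed on the left below by means of
    \<open>eps_A\<close>; this doubles the Gronwall weights and the constant.\<close>
  define a where "a k = 2 * (\<epsilon> * norm (e k) + \<epsilon>\<^sup>2 * norm (P (Suc k)))" for k
  have sum_e': "(\<Sum>k<n. \<epsilon> * norm (e k)) \<le> \<epsilon> * E" if "n \<le> N" for n
  proof -
    have "(\<Sum>k<n. norm (e k)) \<le> (\<Sum>k<N. norm (e k))"
      using that by (intro sum_mono2) auto
    with sum_e have "(\<Sum>k<n. norm (e k)) \<le> E" by (simp add: e_def)
    then show ?thesis using eps by (simp flip: sum_distrib_left)
  qed
  have sum_P': "(\<Sum>k<n. \<epsilon>\<^sup>2 * norm (P (Suc k))) \<le> \<epsilon>\<^sup>2 * B" if "n \<le> N" for n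
  proof -
    have "(\<Sum>k<n. norm (P (Suc k))) \<le> (\<Sum>k<N. norm (P (Suc k)))"
      using that by (intro sum_mono2) auto
    with sum_P have "(\<Sum>k<n. norm (P (Suc k))) \<le> B" by simp
    then show ?thesis using eps by (simp flip: sum_distrib_left)
  qed
  have "norm (v n) \<le> 2 * (2 * (\<epsilon> * A) + \<epsilon> * E) * exp (\<Sum>k<n. a k)"
  proof (rule discrete_gronwall[where N = N])
    show "0 \<le> a k" for k using eps by (simp add: a_def)
    show "0 \<le> 2 * (2 * (\<epsilon> * A) + \<epsilon> * E)" using eps A_nonneg E_nonneg by simp
    fix n assume n: "n \<le> N"
    have "norm (Z n) = norm (Z 0 + (\<Sum>k<n. Z (Suc k) - Z k))"
      by (simp add: sum_lessThan_telescope)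
    also have "\<dots> \<le> norm (Z 0) + (\<Sum>k<n. norm (Z (Suc k) - Z k))"
      by (rule order_trans[OF norm_triangle_ineq add_left_mono[OF norm_sum]])
    also have "norm (Z 0) \<le> \<epsilon> * A"
      using P_le[of 0] eps by (simp add: Z_def u0 v0 norm_mult)
    also have "(\<Sum>k<n. norm (Z (Suc k) - Z k)) \<le>
        (\<Sum>k<n. \<epsilon> * norm (e k) + a k / 2 * norm (v k))"
      by (intro sum_mono order_trans[OF norm_Z_diff]) (simp add: a_def algebra_simps)
    also have "\<dots> \<le> \<epsilon> * E + (\<Sum>k<n. a k * norm (v k)) / 2"
      using sum_e'[OF n] by (simp add: sum.distrib flip: sum_divide_distrib)
    finally have Zn: "norm (Z n) \<le> \<epsilon> * A + (\<epsilon> * E + (\<Sum>k<n. a k * norm (v k)) / 2)" by simp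
    have "norm (v n) \<le> norm (Z n) + norm (\<epsilon> * P n * u n)"
      unfolding Z_def by (metis diff_add_cancel norm_triangle_ineq)
    also have "norm (\<epsilon> * P n * u n) \<le> \<epsilon> * A * (1 + norm (v n))"
      unfolding norm_mult using eps P_le[OF n] u_le[of n] A_nonneg
      by (intro mult_mono) auto
    also have "\<dots> \<le> \<epsilon> * A + norm (v n) / 2"
      using mult_right_mono[OF eps_A norm_ge_zero[of "v n"]] by (simp add: algebra_simps)
    finally have "norm (v n) \<le> norm (Z n) + (\<epsilon> * A + norm (v n) / 2)" by simp
    with Zn show "norm (v n) \<le> 2 * (2 * (\<epsilon> * A) + \<epsilon> * E) + (\<Sum>k<n. a k * norm (v k))"
      by (simp add: field_simps)
  qed (rule assms)
  also have "(\<Sum>k<n. a k) \<le> 2 * (\<epsilon> * E + \<epsilon>\<^sup>2 * B)"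
    using sum_e'[OF assms] sum_P'[OF assms] by (simp add: a_def sum.distrib flip: sum_distrib_left)
  finally show ?thesis
    using eps A_nonneg E_nonneg by (simp add: V_def mult_left_mono)
qed

definition W :: real where "W = V + \<epsilon> * A * (1 + V)"

lemma W_nonneg: "0 \<le> W"
  using eps A_nonneg V_nonneg by (simp add: W_def)

lemma norm_Z_le:
  assumes "n \<le> N"
  shows "norm (Z n) \<le> W"
proof -
  have "norm (Z n) \<le> norm (v n) + norm (\<epsilon> * P n * u n)"
    unfolding Z_def by (rule norm_triangle_ineq4)
  also have "norm (\<epsilon> * P n * u n) \<le> \<epsilon> * A * (1 + V)"
    unfolding norm_mult using eps P_le[OF assms] u_le[of n] A_nonneg norm_v_le[OF assms]
    by (intro mult_mono) auto
  finally show ?thesis using norm_v_le[OF assms] by (simp add: W_def)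
qed

text \<open>Summing \<open>u_diff\<close> leaves only the sum of
  \<open>\<epsilon> * cnj (w k) * Z k\<close> to control. Here \<open>cnj (w k)\<close> is an
  increment of \<open>cnj (P k)\<close> up to \<open>cnj (e k)\<close>, so summation by parts moves
  the difference onto the slowly varying \<open>Z\<close>.\<close>

lemma u_drift:
  assumes "m \<le> n" "n \<le> N"
  shows "norm (u n - u m - \<epsilon>\<^sup>2 * (\<Sum>k=m..<n. cnj (w k) * P k * u k))
    \<le> (2 * (\<epsilon> * A) + \<epsilon> * E) * W + \<epsilon> * A * (\<epsilon> * E * (1 + V) + \<epsilon>\<^sup>2 * B * V)"
proof -
  have sub: "(\<Sum>k=m..<n. f k) \<le> (\<Sum>k<N. f k)" if "\<And>k. 0 \<le> f k" for f :: "nat \<Rightarrow> real"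
    using assms that by (intro sum_mono2) auto
  have "u n - u m = (\<Sum>k=m..<n. u (Suc k) - u k)"
    using assms by (simp add: sum_Suc_diff')
  also have "\<dots> = \<epsilon>\<^sup>2 * (\<Sum>k=m..<n. cnj (w k) * P k * u k) + \<epsilon> * (\<Sum>k=m..<n. cnj (w k) * Z k)"
    unfolding u_diff by (simp add: sum.distrib sum_distrib_left)
  finally have "u n - u m - \<epsilon>\<^sup>2 * (\<Sum>k=m..<n. cnj (w k) * P k * u k) =
      \<epsilon> * (\<Sum>k=m..<n. cnj (w k) * Z k)" by simp
  also have "(\<Sum>k=m..<n. cnj (w k) * Z k) =
     (\<Sum>k=m..<n. (cnj (P (Suc k)) - cnj (P k)) * Z k) + (\<Sum>k=m..<n. cnj (e k) * Z k)"
    by (simp add: e_def algebra_simps flip: sum.distrib)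
  also have "(\<Sum>k=m..<n. (cnj (P (Suc k)) - cnj (P k)) * Z k) =
     cnj (P n) * Z n - cnj (P m) * Z m - (\<Sum>k=m..<n. cnj (P (Suc k)) * (Z (Suc k) - Z k))"
    using summation_by_parts[OF assms(1), of "\<lambda>k. cnj (P k)" Z] by simp
  finally have eq: "u n - u m - \<epsilon>\<^sup>2 * (\<Sum>k=m..<n. cnj (w k) * P k * u k) =
     \<epsilon> * (cnj (P n) * Z n - cnj (P m) * Z m - (\<Sum>k=m..<n. cnj (P (Suc k)) * (Z (Suc k) - Z k))
       + (\<Sum>k=m..<n. cnj (e k) * Z k))" .
  have PZ: "norm (cnj (P k) * Z k) \<le> A * W" if "k \<le> N" for k
    unfolding norm_mult complex_mod_cnj
    using P_le[OF that] norm_Z_le[OF that] A_nonneg by (intro mult_mono) auto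
  have "norm (\<Sum>k=m..<n. cnj (e k) * Z k) \<le> (\<Sum>k=m..<n. norm (e k) * W)"
    using assms norm_Z_le by (intro sum_norm_le) (auto simp: norm_mult intro!: mult_left_mono)
  also have "\<dots> \<le> E * W"
  proof -
    have "(\<Sum>k=m..<n. norm (e k)) \<le> E"
      using sub[of "\<lambda>k. norm (e k)"] sum_e by (simp add: e_def)
    then show ?thesis using W_nonneg by (simp add: mult_right_mono flip: sum_distrib_right)
  qed
  finally have eZ: "norm (\<Sum>k=m..<n. cnj (e k) * Z k) \<le> E * W" .
  have "norm (\<Sum>k=m..<n. cnj (P (Suc k)) * (Z (Suc k) - Z k)) \<le>
     (\<Sum>k=m..<n. A * (\<epsilon> * (1 + V) * norm (e k) + \<epsilon>\<^sup>2 * V * norm (P (Suc k))))"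
  proof (rule sum_norm_le)
    fix k assume k: "k \<in> {m..<n}"
    have "norm (Z (Suc k) - Z k) \<le> \<epsilon> * norm (e k) * (1 + V) + \<epsilon>\<^sup>2 * norm (P (Suc k)) * V"
      using eps assms k norm_v_le[of k]
      by (intro order_trans[OF norm_Z_diff] add_mono mult_left_mono) auto
    then show "norm (cnj (P (Suc k)) * (Z (Suc k) - Z k))
       \<le> A * (\<epsilon> * (1 + V) * norm (e k) + \<epsilon>\<^sup>2 * V * norm (P (Suc k)))"
      unfolding norm_mult complex_mod_cnj using P_le[of "Suc k"] assms k A_nonneg
      by (intro mult_mono) (auto simp: algebra_simps)
  qed
  also have "\<dots> = A * (\<epsilon> * (1 + V) * (\<Sum>k=m..<n. norm (e k)) +
      \<epsilon>\<^sup>2 * V * (\<Sum>k=m..<n. norm (P (Suc k))))"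
    by (simp add: sum.distrib flip: sum_distrib_left)
  also have "\<dots> \<le> A * (\<epsilon> * (1 + V) * E + \<epsilon>\<^sup>2 * V * B)"
    using sub[of "\<lambda>k. norm (e k)"] sub[of "\<lambda>k. norm (P (Suc k))"] sum_e sum_P eps V_nonneg A_nonneg
    by (intro mult_left_mono add_mono) (auto simp: e_def)
  finally have dZ: "norm (\<Sum>k=m..<n. cnj (P (Suc k)) * (Z (Suc k) - Z k)) \<le>
      A * (\<epsilon> * (1 + V) * E + \<epsilon>\<^sup>2 * V * B)" .
  have tri: "norm (a - b - c + d) \<le> norm a + norm b + norm c + norm d" for a b c d :: complex
    by norm
  have "norm (u n - u m - \<epsilon>\<^sup>2 * (\<Sum>k=m..<n. cnj (w k) * P k * u k)) \<le>
     \<epsilon> * (A * W + A * W + A * (\<epsilon> * (1 + V) * E + \<epsilon>\<^sup>2 * V * B) + E * W)"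
  proof -
    have "norm (cnj (P n) * Z n - cnj (P m) * Z m - (\<Sum>k=m..<n. cnj (P (Suc k)) * (Z (Suc k) - Z k))
       + (\<Sum>k=m..<n. cnj (e k) * Z k)) \<le> A * W + A * W + A * (\<epsilon> * (1 + V) * E + \<epsilon>\<^sup>2 * V * B) + E * W"
      using tri PZ[of n] PZ[of m] eZ dZ assms by (smt (verit) le_trans)
    then show ?thesis unfolding eq norm_mult using eps by (simp add: mult_left_mono)
  qed
  also have "\<dots> = (2 * (\<epsilon> * A) + \<epsilon> * E) * W + \<epsilon> * A * (\<epsilon> * E * (1 + V) + \<epsilon>\<^sup>2 * B * V)"
    by (simp add: algebra_simps)
  finally show ?thesis .
qed

end

text \<open>\<open>1 / x\<close>, smoothed near \<open>x = 0\<close> at scale \<open>sqrt t\<close>; this makes a separate treatment of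
  the resonant times unnecessary.\<close>

definition reg_inv :: "real \<Rightarrow> complex \<Rightarrow> complex" where
  "reg_inv t x = cnj x / (norm x ^ 2 + t)"

text \<open>A smoothed \<open>1 / norm x\<close>: it dominates \<open>reg_inv\<close>, and products
  of two of its values control both the increments of \<open>reg_inv\<close> and the defect caused
  by smoothing.\<close>

definition reg_abs :: "real \<Rightarrow> complex \<Rightarrow> real" where
  "reg_abs t x = 1 / sqrt (norm x ^ 2 + t)"

lemma reg_abs_pos: "t > 0 \<Longrightarrow> 0 < reg_abs t x"
  by (simp add: reg_abs_def add_nonneg_pos)

lemma reg_abs_sq: "t > 0 \<Longrightarrow> reg_abs t x ^ 2 = 1 / (norm x ^ 2 + t)"
  by (simp add: reg_abs_def power_divide add_nonneg_nonneg)

lemma norm_reg_denom: "t > 0 \<Longrightarrow> norm (complex_of_real (norm x) ^ 2 + of_real t) = norm x ^ 2 + t"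
  for x :: complex
proof -
  assume "t > 0"
  have "complex_of_real (norm x) ^ 2 + of_real t = of_real (norm x ^ 2 + t)" by simp
  then show ?thesis using \<open>t > 0\<close> by (simp only: norm_of_real) simp
qed

lemma norm_reg_inv_le:
  assumes "t > 0"
  shows "norm (reg_inv t x) \<le> reg_abs t x"
proof -
  have p: "norm x ^ 2 + t > 0" using assms by (simp add: add_nonneg_pos)
  have "norm x \<le> sqrt (norm x ^ 2 + t)"
    using assms by (intro real_le_rsqrt) simp
  then have "norm x / (norm x ^ 2 + t) \<le> sqrt (norm x ^ 2 + t) / (norm x ^ 2 + t)"
    using p by (intro divide_right_mono) auto
  also have "\<dots> = reg_abs t x"
    using p by (simp add: reg_abs_def real_div_sqrt field_simps)
  finally show ?thesis
    using assms by (simp add: reg_inv_def norm_divide norm_reg_denom)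
qed

lemma reg_abs_le:
  assumes "t > 0"
  shows "reg_abs t x \<le> 1 / sqrt t"
  using assms by (auto simp: reg_abs_def intro!: divide_left_mono mult_pos_pos add_nonneg_pos)

text \<open>Smoothed counterpart of \<open>1 / x - 1 / y = (y - x) / (x * y)\<close>; the extra
  numerator term containing \<open>t\<close> is absorbed by Cauchy-Schwarz.\<close>

lemma norm_reg_inv_diff:
  assumes t: "t > 0"
  shows "norm (reg_inv t x - reg_inv t y) \<le> norm (x - y) * (reg_abs t x * reg_abs t y)"
proof -
  define X Y where "X = norm x ^ 2 + t" and "Y = norm y ^ 2 + t"
  have pos: "X > 0" "Y > 0" using t by (auto simp: X_def Y_def add_nonneg_pos)
  have xx: "of_real X = x * cnj x + of_real t" "of_real Y = y * cnj y + of_real t"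
    by (simp_all add: X_def Y_def flip: complex_norm_square)
  have "reg_inv t x - reg_inv t y = (cnj x * of_real Y - cnj y * of_real X) / (of_real X * of_real Y)"
  proof -
    have "reg_inv t x = cnj x / of_real X" "reg_inv t y = cnj y / of_real Y"
      by (simp_all add: reg_inv_def X_def Y_def)
    then show ?thesis using pos by (simp add: diff_frac_eq mult.commute)
  qed
  also have "cnj x * of_real Y - cnj y * of_real X = cnj x * cnj y * (y - x) + of_real t * (cnj x - cnj y)"
    unfolding xx by (simp add: algebra_simps)
  finally have "norm (reg_inv t x - reg_inv t y) =
      norm (cnj x * cnj y * (y - x) + of_real t * (cnj x - cnj y)) / (X * Y)"
    using pos by (simp add: norm_divide norm_mult)
  also have "norm (cnj x * cnj y * (y - x) + of_real t * (cnj x - cnj y)) \<le>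
      norm (x - y) * (norm x * norm y + t)"
  proof -
    have "norm (cnj x - cnj y) = norm (x - y)"
      by (metis complex_cnj_diff complex_mod_cnj)
    then have "norm (cnj x * cnj y * (y - x)) + norm (of_real t * (cnj x - cnj y)) =
        norm (x - y) * (norm x * norm y + t)"
      using t unfolding norm_mult by (simp add: norm_minus_commute algebra_simps)
    then show ?thesis by (metis norm_triangle_ineq)
  qed
  \<comment> \<open>Cauchy-Schwarz for the vectors \<open>(norm x, sqrt t)\<close> and
    \<open>(norm y, sqrt t)\<close>.\<close>
  also have "norm x * norm y + t \<le> sqrt X * sqrt Y"
  proof -
    have "(norm x * norm y + t)\<^sup>2 \<le> X * Y"
      using t sum_squares_bound[of "norm x" "norm y"]
        mult_left_mono[OF sum_squares_bound[of "norm x" "norm y"], of t]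
      by (simp add: X_def Y_def power2_eq_square algebra_simps)
    then show ?thesis using pos by (simp add: real_le_rsqrt flip: real_sqrt_mult)
  qed
  finally have "norm (reg_inv t x - reg_inv t y) \<le> norm (x - y) * (sqrt X * sqrt Y) / (X * Y)"
    using pos by (simp add: divide_right_mono mult_left_mono)
  also have "\<dots> = norm (x - y) * (1 / sqrt X * (1 / sqrt Y))"
    using pos by (simp add: field_simps)
  finally show ?thesis by (simp add: reg_abs_def X_def Y_def)
qed

lemma one_minus_mult_reg_inv:
  assumes "t > 0"
  shows "norm (1 - x * reg_inv t x) = t * reg_abs t x ^ 2"
proof -
  define X where "X = norm x ^ 2 + t"
  have pos: "X > 0" using assms by (auto simp: X_def add_nonneg_pos)
  have "x * reg_inv t x = of_real ((norm x)\<^sup>2 / X)"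
    by (simp add: reg_inv_def X_def flip: complex_norm_square)
  then have "1 - x * reg_inv t x = of_real (1 - (norm x)\<^sup>2 / X)" by simp
  also have "1 - (norm x)\<^sup>2 / X = t / X"
    using pos by (simp add: diff_divide_eq_iff) (simp add: X_def)
  finally have "1 - x * reg_inv t x = of_real (t / X)" .
  then show ?thesis using pos assms by (simp add: reg_abs_sq X_def[symmetric] norm_divide)
qed

lemma Im_reg_inv: "Im (reg_inv t (cis q - 1)) = - sin q / (norm (cis q - 1) ^ 2 + t)"
  by (simp add: reg_inv_def Im_divide_of_real flip: of_real_power of_real_add)

text \<open>The real part of \<open>1 / (cis q - 1)\<close> is exactly \<open>-1/2\<close> wherever
  it is defined, and smoothing only shrinks it. The growth near resonance thus sits in the imaginary
  part, which is what makes the feedback a rotation.\<close>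

lemma abs_Re_reg_inv:
  assumes "t > 0"
  shows "\<bar>Re (reg_inv t (cis q - 1))\<bar> \<le> 1 / 2"
proof -
  have "(norm (cis q - 1))\<^sup>2 = 2 - 2 * cos q"
    unfolding cmod_power2 using sin_cos_squared_add[of q]
    by (simp add: power2_eq_square algebra_simps)
  moreover have "cos q \<le> 1" by simp
  ultimately have "2 - 2 * cos q + t > 0" "\<bar>cos q - 1\<bar> = 1 - cos q"
    and sq: "(norm (cis q - 1))\<^sup>2 = 2 - 2 * cos q" using assms by linarith+
  then show ?thesis using assms
    by (simp add: reg_inv_def sq divide_le_eq flip: of_real_power of_real_add)
qed

section \<open>Sums along a sweep of the circle\<close>

lemma sum_lessThan_add: "(\<Sum>k<a + b. f k) = (\<Sum>k<a. f k) + (\<Sum>k<b. f (a + k))"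
  for f :: "nat \<Rightarrow> real"
  by (induction b) (simp_all add: algebra_simps)

lemma sum_periodic_shift:
  fixes f :: "nat \<Rightarrow> real"
  assumes "\<And>k. f (M + k) = f k"
  shows "(\<Sum>k<M. f (j + k)) = (\<Sum>k<M. f k)"
proof (induction j)
  case (Suc j)
  have "(\<Sum>k<Suc M. f (j + k)) = f j + (\<Sum>k<M. f (Suc j + k))"
    by (simp add: sum.lessThan_Suc_shift del: sum.lessThan_Suc)
  moreover have "(\<Sum>k<Suc M. f (j + k)) = (\<Sum>k<M. f (j + k)) + f j"
    using assms[of j] by (simp add: add.commute)
  ultimately show ?case using Suc by simp
qed simp

text \<open>Jordan's inequality: sine is concave on \<open>{0..pi/2}\<close> and so lies above its
  chord.\<close>

lemma two_div_pi_le_sin: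
  assumes "0 \<le> x" "x \<le> pi / 2"
  shows "2 * x / pi \<le> sin x"
proof -
  have "convex_on {0..pi/2} (\<lambda>x. - sin x)"
  proof (rule f''_ge0_imp_convex)
    show "((\<lambda>x. - sin x) has_real_derivative - cos x) (at x)" for x :: real
      by (auto intro!: derivative_eq_intros)
    show "((\<lambda>x. - cos x) has_real_derivative sin x) (at x)" for x :: real
      by (auto intro!: derivative_eq_intros)
    show "0 \<le> sin x" if "x \<in> {0..pi/2}" for x
      using that by (intro sin_ge_zero) auto
  qed auto
  from convex_onD[OF this, of "2 * x / pi" 0 "pi / 2"] assms show ?thesis
    by (simp add: field_simps)
qed

lemma norm_cis_minus_1: "norm (cis t - 1) = 2 * \<bar>sin (t / 2)\<bar>"
  using dist_exp_i_1[of t] by (simp add: cis_conv_exp)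

lemma norm_cis_minus_1_le: "norm (cis t - 1) \<le> \<bar>t\<bar>"
  unfolding norm_cis_minus_1 using abs_sin_x_le_abs_x[of "t/2"] by simp

lemma resonance_time:
  fixes M :: nat
  assumes "norm z = 1" "0 < M"
  obtains k :: nat and \<theta> where "k \<le> M" "0 \<le> \<theta>" "\<theta> < 1" "cis (2 * pi * k / M) * z = cis (2 * pi * \<theta> / M)"
proof -
  \<comment> \<open>With the argument nonpositive and above \<open>- 2 * pi\<close>, the real time
    \<open>x\<close> at which the phase is exactly 1 lies in \<open>{0..M}\<close>; rounding it up
    leaves the offset \<theta>.\<close>
  obtain \<phi> where \<phi>: "z = cis \<phi>" "- 2 * pi < \<phi>" "\<phi> \<le> 0"
  proof (cases "Arg z \<le> 0")
    case True
    then show ?thesis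
      using that[of "Arg z"] Arg_bounded[of z] rcis_cmod_Arg[of z] assms by (simp add: rcis_def)
  next
    case False
    have "cis (Arg z - 2 * pi) = cis (Arg z)"
      by (simp add: complex_eq_iff cos_diff sin_diff)
    then show ?thesis
      using that[of "Arg z - 2 * pi"] False Arg_bounded[of z] rcis_cmod_Arg[of z] assms
      by (simp add: rcis_def)
  qed
  define x where "x = - \<phi> * M / (2 * pi)"
  have x: "0 \<le> x" "x \<le> M"
    using \<phi> assms mult_right_mono[of "- \<phi>" "2 * pi" "real M"]
    by (auto simp: x_def divide_simps mult_nonpos_nonneg mult.commute)
  define k where "k = nat \<lceil>x\<rceil>"
  have k: "x \<le> k" "real k < x + 1"
    unfolding k_def using x by linarith+
  have "\<phi> = - (2 * pi * x / M)"
    using assms by (simp add: x_def)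
  then have "cis (2 * pi * k / M) * z = cis (2 * pi * (k - x) / M)"
    unfolding \<phi>(1) cis_mult by (simp add: diff_divide_distrib right_diff_distrib)
  moreover have "k \<le> M"
    using x unfolding k_def by (simp add: nat_le_iff ceiling_le_iff)
  ultimately show thesis using that[of k "k - x"] k by auto
qed

section \<open>Logarithmic and square sums around a resonance\<close>

lemma sum_inverse_ge_ln:
  fixes a b :: nat
  assumes "a \<le> b"
  shows "ln (real b + 1) - ln (real a + 1) \<le> (\<Sum>r=a..<b. 1 / (real r + 1))"
  using assms
proof (induction b rule: dec_induct)
  case (step n)
  have "ln ((real n + 2) / (real n + 1)) \<le> (real n + 2) / (real n + 1) - 1"
    by (intro ln_le_minus_one) auto
  also have "\<dots> = 1 / (real n + 1)" by (simp add: field_simps)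
  finally have "ln (real n + 2) - ln (real n + 1) \<le> 1 / (real n + 1)" by (simp add: ln_div)
  with step show ?case by (simp add: add.commute[of 2])
qed simp

text \<open>Majorant of \<open>reg_abs (1 / M)\<close> at least \<open>r\<close> steps from
  resonance: by Jordan's inequality \<open>cis (2 * pi * x)\<close> is at distance at least
  \<open>4 * x\<close> from 1 for \<open>0 \<le> x \<le> 1/2\<close>.\<close>

definition peak :: "nat \<Rightarrow> nat \<Rightarrow> real" where
  "peak M r = 1 / sqrt (16 * real r ^ 2 / real M ^ 2 + 1 / real M)"

lemma peak_nonneg: "0 \<le> peak M r"
  by (simp add: peak_def)

lemma reg_abs_le_peak:
  assumes "0 < M" "4 * real r / M \<le> norm x"
  shows "reg_abs (1 / M) x \<le> peak M r"
proof -
  have "(4 * real r / M)\<^sup>2 \<le> norm x ^ 2"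
    using assms by (intro power_mono) auto
  then show ?thesis unfolding reg_abs_def peak_def using assms
    by (intro divide_left_mono mult_pos_pos real_sqrt_le_mono)
       (auto simp: power_divide power_mult_distrib add_nonneg_pos)
qed

text \<open>In the first half turn the resonance just passed is the nearer one, afterwards the next
  one. \<open>M - Suc r\<close> in place of \<open>M - r\<close> allows for \<theta> < 1, and adding
  both majorants avoids a case split in the sums.\<close>

lemma reg_abs_power_le_peaks:
  assumes "r < M" "0 \<le> \<theta>" "\<theta> < 1"
  shows "reg_abs (1 / M) (cis (2 * pi * (r + \<theta>) / M) - 1) ^ i \<le> peak M r ^ i + peak M (M - Suc r) ^ i"
proof -
  define x where "x = (r + \<theta>) / M"
  have q: "2 * pi * (r + \<theta>) / M = 2 * pi * x" by (simp add: x_def)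
  have x: "0 \<le> x" "x \<le> 1" using assms by (auto simp: x_def divide_simps)
  have le: "reg_abs (1 / M) (cis (2 * pi * x) - 1) \<le> peak M r \<or>
    reg_abs (1 / M) (cis (2 * pi * x) - 1) \<le> peak M (M - Suc r)"
  proof (cases "x \<le> 1 / 2")
    case True
    then have "2 * x \<le> sin (pi * x)"
      using two_div_pi_le_sin[of "pi * x"] x by simp
    moreover have "real r / M \<le> x" using assms by (simp add: x_def divide_right_mono)
    ultimately have "4 * real r / M \<le> norm (cis (2 * pi * x) - 1)"
      using x by (simp add: norm_cis_minus_1)
    then show ?thesis using assms reg_abs_le_peak by simp
  next
    case False
    have "sin (pi * (1 - x)) = sin (pi * x)"
      by (simp add: right_diff_distrib sin_diff)
    moreover have "2 * (1 - x) \<le> sin (pi * (1 - x))"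
      using two_div_pi_le_sin[of "pi * (1 - x)"] x False by simp
    ultimately have "2 * (1 - x) \<le> sin (pi * x)" by simp
    moreover have "real (M - Suc r) / M \<le> 1 - x"
      using assms by (simp add: x_def field_simps of_nat_diff)
    ultimately have "4 * real (M - Suc r) / M \<le> norm (cis (2 * pi * x) - 1)"
      using x by (simp add: norm_cis_minus_1)
    then show ?thesis using assms reg_abs_le_peak by simp
  qed
  have nn: "0 \<le> reg_abs (1 / M) (cis (2 * pi * x) - 1)"
    using assms by (intro less_imp_le[OF reg_abs_pos]) auto
  from le show ?thesis unfolding q
  proof
    assume "reg_abs (1 / M) (cis (2 * pi * x) - 1) \<le> peak M r"
    from power_mono[OF this nn, of i] show "reg_abs (1 / M) (cis (2 * pi * x) - 1) ^ i \<le> peak M r ^ i + peak M (M - Suc r) ^ i"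
      using zero_le_power[OF peak_nonneg, of M "M - Suc r" i] by linarith
  next
    assume "reg_abs (1 / M) (cis (2 * pi * x) - 1) \<le> peak M (M - Suc r)"
    from power_mono[OF this nn, of i] show "reg_abs (1 / M) (cis (2 * pi * x) - 1) ^ i \<le> peak M r ^ i + peak M (M - Suc r) ^ i"
      using zero_le_power[OF peak_nonneg, of M r i] by linarith
  qed
qed

lemma cis_shift_period: "0 < M \<Longrightarrow> cis (2 * pi * real (M + k) / M) = cis (2 * pi * real k / M)"
proof -
  assume "0 < M"
  then have "2 * pi * real (M + k) / M = 2 * pi + 2 * pi * real k / M" by (simp add: field_simps)
  then show ?thesis by (simp only: cis_mult[symmetric]) simp
qed

text \<open>The summand has period \<open>M\<close> in \<open>k\<close>, so each sweep may be taken
  to start at its resonance. The factor 4 counts two sweeps and the two sides of a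
  resonance.\<close>

lemma sum_reg_abs_power_le:
  assumes "norm z = 1" "0 < M"
  shows "(\<Sum>k<2 * M. reg_abs (1 / M) (cis (2 * pi * real k / M) * z - 1) ^ i) \<le> 4 * (\<Sum>r<M. peak M r ^ i)"
proof -
  define f where "f k = reg_abs (1 / M) (cis (2 * pi * real k / M) * z - 1) ^ i" for k :: nat
  have per: "f (M + k) = f k" for k
    using cis_shift_period[OF assms(2), of k] by (simp add: f_def)
  obtain k0 \<theta> where k0: "0 \<le> \<theta>" "\<theta> < 1" "cis (2 * pi * real k0 / M) * z = cis (2 * pi * \<theta> / M)"
    using resonance_time[OF assms] by metis
  have f_k0: "f (k0 + r) \<le> peak M r ^ i + peak M (M - Suc r) ^ i" if "r < M" for r
  proof -
    have "cis (2 * pi * real (k0 + r) / M) * z = cis (2 * pi * real r / M) * (cis (2 * pi * real k0 / M) * z)"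
      by (simp add: cis_mult add_divide_distrib ring_distribs mult.assoc[symmetric] add.commute)
    also have "\<dots> = cis (2 * pi * (r + \<theta>) / M)"
      unfolding k0(3) by (simp add: cis_mult add_divide_distrib ring_distribs)
    finally show ?thesis
      unfolding f_def using reg_abs_power_le_peaks[OF that k0(1,2), of i] by simp
  qed
  have "(\<Sum>k<2 * M. f k) = 2 * (\<Sum>k<M. f (k0 + k))"
    unfolding mult_2 sum_lessThan_add by (simp add: per sum_periodic_shift)
  also have "(\<Sum>k<M. f (k0 + k)) \<le> (\<Sum>r<M. peak M r ^ i + peak M (M - Suc r) ^ i)"
    by (intro sum_mono f_k0) auto
  also have "\<dots> = 2 * (\<Sum>r<M. peak M r ^ i)"
    using sum.nat_diff_reindex[of "\<lambda>r. peak M r ^ i" M] by (simp add: sum.distrib)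
  finally show ?thesis by (simp add: f_def)
qed

text \<open>At \<open>r = 0\<close> smoothing caps the peak at \<open>sqrt M = m\<close>; elsewhere
  it is at most \<open>M / (4 * r)\<close>, and the harmonic sum produces the logarithm.\<close>

lemma sum_peak_le:
  fixes m M :: nat
  assumes m: "0 < m" and M: "M = m\<^sup>2"
  shows "(\<Sum>r<M. peak M r) \<le> m + M / 4 * (1 + 2 * ln m)"
proof -
  have M0: "0 < M" using assms by simp
  have sq: "sqrt (real M) = m" by (simp add: M)
  have p0: "peak M 0 = m" using m by (simp add: peak_def real_sqrt_divide sq)
  have pr: "peak M r \<le> M / 4 * (1 / real r)" if "0 < r" for r
  proof -
    have "4 * real r / M \<le> sqrt (16 * real r ^ 2 / real M ^ 2 + 1 / real M)"
      using M0 by (intro real_le_rsqrt) (simp add: power_divide power_mult_distrib)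
    then have "1 / sqrt (16 * real r ^ 2 / real M ^ 2 + 1 / real M) \<le> 1 / (4 * real r / M)"
      using that M0 by (intro divide_left_mono mult_pos_pos) (auto simp: add_pos_pos)
    then show ?thesis using that by (simp add: peak_def)
  qed
  have "(\<Sum>r<Suc n. peak M r) \<le> m + M / 4 * (1 + ln n)" if "1 \<le> n" for n
    using that
  proof (induction n rule: dec_induct)
    case base
    show ?case using pr[of 1] by (simp add: p0)
  next
    case (step n)
    have "ln (real n / (real n + 1)) \<le> real n / (real n + 1) - 1"
      using step by (intro ln_le_minus_one) auto
    also have "\<dots> = - 1 / (real n + 1)" by (simp add: field_simps)
    finally have "1 / (real n + 1) \<le> ln (real n + 1) - ln n" using step by (simp add: ln_div)
    then have "M / 4 * (1 / real (Suc n)) \<le> M / 4 * (ln (Suc n) - ln n)"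
      by (intro mult_left_mono) (auto simp: add.commute)
    with pr[of "Suc n"] have "peak M (Suc n) \<le> M / 4 * (ln (Suc n) - ln n)" by linarith
    moreover have "M / 4 * (1 + ln (Suc n)) = M / 4 * (1 + ln n) + M / 4 * (ln (Suc n) - ln n)"
      by (simp add: distrib_left right_diff_distrib)
    ultimately show ?case
      using step.IH unfolding sum.lessThan_Suc[of "peak M" "Suc n"] by linarith
  qed
  from this[of M] have "(\<Sum>r<Suc M. peak M r) \<le> m + M / 4 * (1 + ln M)" using M0 by simp
  moreover have "ln (real M) = 2 * ln m" using m by (simp add: M ln_realpow)
  ultimately show ?thesis using peak_nonneg[of M M] by simp
qed

text \<open>Squaring makes the tail summable, so no logarithm appears. The bound
  \<open>16 * r^2 + M \<ge> (m + r)^2 / 2\<close> reduces the terms to multiples of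
  \<open>1 / (m + r)^2\<close>, which are dominated by a telescoping sum.\<close>

lemma sum_peak_sq_le:
  fixes m M :: nat
  assumes m: "2 \<le> m" and M: "M = m\<^sup>2"
  shows "(\<Sum>r<M. peak M r ^ 2) \<le> 4 * real M * m"
proof -
  have M0: "0 < M" using assms by simp
  have pr: "peak M r ^ 2 \<le> 2 * real M ^ 2 * (1 / (real m + r - 1) - 1 / (real m + r))" for r
  proof -
    have "peak M r ^ 2 = 1 / (16 * real r ^ 2 / real M ^ 2 + 1 / real M)"
      using M0 by (simp add: peak_def power_divide)
    also have "\<dots> = real M ^ 2 / (16 * real r ^ 2 + real M)"
      using M0 by (simp add: field_simps power2_eq_square)
    also have "\<dots> \<le> real M ^ 2 / ((real m + r)\<^sup>2 / 2)"
    proof (intro divide_left_mono)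
      have "(x + y + z) / 2 \<le> 16 * y + x" if "z \<le> x + y" "0 \<le> y" for x y z :: real
        using that by simp
      then show "(real m + real r)\<^sup>2 / 2 \<le> 16 * (real r)\<^sup>2 + real M"
        using sum_squares_bound[of "real m" "real r"] zero_le_power2[of "real r"]
        unfolding M of_nat_power power2_sum by blast
    qed (use M0 m in \<open>auto intro!: mult_pos_pos add_nonneg_pos\<close>)
    also have "\<dots> = 2 * real M ^ 2 * (1 / (real m + r)\<^sup>2)" by simp
    also have "\<dots> \<le> 2 * real M ^ 2 * (1 / (real m + r - 1) - 1 / (real m + r))"
    proof (intro mult_left_mono)
      define x where "x = real m + real r"
      have "1 < x" using m by (simp add: x_def)
      then have "1 / (x - 1) - 1 / x = 1 / (x * (x - 1))" by (simp add: field_simps)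
      moreover have "1 / x\<^sup>2 \<le> 1 / (x * (x - 1))"
        using \<open>1 < x\<close> by (intro frac_le) (auto simp: power2_eq_square)
      ultimately show "1 / (real m + r)\<^sup>2 \<le> 1 / (real m + r - 1) - 1 / (real m + r)"
        by (simp add: x_def)
    qed simp
    finally show ?thesis .
  qed
  have "(\<Sum>r<n. peak M r ^ 2) \<le> 2 * real M ^ 2 * (1 / (real m - 1) - 1 / (real m + n - 1))" for n
  proof (induction n)
    case (Suc n)
    with pr[of n] show ?case by (simp add: algebra_simps)
  qed simp
  from this[of M] have "(\<Sum>r<M. peak M r ^ 2) \<le> 2 * real M ^ 2 * (1 / (real m - 1) - 1 / (real m + M - 1))" .
  also have "\<dots> \<le> 2 * real M ^ 2 * (2 / m)"
  proof (intro mult_left_mono)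
    have "1 / (real m - 1) \<le> 2 / m" using m by (simp add: field_simps)
    moreover have "0 \<le> 1 / (real m + M - 1)" using m by simp
    ultimately show "1 / (real m - 1) - 1 / (real m + M - 1) \<le> 2 / m" by linarith
  qed simp
  also have "\<dots> = 4 * real M * m" using m by (simp add: M power2_eq_square)
  finally show ?thesis .
qed

text \<open>Since \<open>M = 4 * p^2\<close>, the window from \<open>2 * p\<close> to
  \<open>p^2\<close> steps past resonance starts where the squared angle is already at least the
  smoothing \<open>1 / M\<close> and ends by a quarter turn. All its terms have one sign and size at
  least of order \<open>M / r\<close>, so the logarithm is not lost to cancellation.\<close>

lemma sum_Im_reg_inv_ge:
  fixes p M :: nat
  assumes "norm z = 1" and p: "3 \<le> p" and M: "M = (2 * p)\<^sup>2"
  obtains a where "a + 2 * p \<le> a + p\<^sup>2" "a + p\<^sup>2 \<le> 2 * M"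
    "real M / 20 * (ln p - 2) \<le> (\<Sum>k=a + 2 * p..<a + p\<^sup>2. - Im (reg_inv (1 / M) (cis (2 * pi * real k / M) * z - 1)))"
    "\<And>k. k \<in> {a + 2 * p..<a + p\<^sup>2} \<Longrightarrow> Im (reg_inv (1 / M) (cis (2 * pi * real k / M) * z - 1)) \<le> 0"
proof -
  have M0: "0 < M" using p by (simp add: M)
  have Mp: "real M = 4 * real p ^ 2" by (simp add: M power_mult_distrib)
  obtain a \<theta> where a: "a \<le> M" "0 \<le> \<theta>" "\<theta> < 1" "cis (2 * pi * real a / M) * z = cis (2 * pi * \<theta> / M)"
    using resonance_time[OF assms(1) M0] by metis
  have le: "2 * p \<le> p\<^sup>2" using p by (simp add: power2_eq_square)
  have term_ge: "real M / 20 * (1 / (real r + 1)) \<le> - Im (reg_inv (1 / M) (cis (2 * pi * real (a + r) / M) * z - 1))"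
    if r: "2 * p \<le> r" "r < p\<^sup>2" for r
  proof -
    define q where "q = 2 * pi * (r + \<theta>) / M"
    have "cis (2 * pi * real (a + r) / M) * z = cis (2 * pi * real r / M) * (cis (2 * pi * real a / M) * z)"
      by (simp add: cis_mult add_divide_distrib ring_distribs mult.assoc[symmetric] add.commute)
    also have "\<dots> = cis q"
      unfolding a(4) q_def by (simp add: cis_mult add_divide_distrib ring_distribs)
    finally have cis: "cis (2 * pi * real (a + r) / M) * z = cis q" .
    have "r + \<theta> \<le> real p ^ 2"
      using r a by (smt (verit) of_nat_Suc of_nat_le_iff of_nat_power Suc_leI)
    then have "2 * pi * (r + \<theta>) \<le> 2 * pi * real p ^ 2" by (intro mult_left_mono) auto
    then have q2: "q \<le> pi / 2"
      using p by (simp add: q_def Mp divide_simps)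
    have q0: "0 < q" using r p a M0 by (simp add: q_def add_pos_nonneg)
    have sin: "2 * q / pi \<le> sin q" using two_div_pi_le_sin[of q] q0 q2 by simp
    have "norm (cis q - 1) ^ 2 \<le> q ^ 2"
      using norm_cis_minus_1_le[of q] q0 by (intro power_mono) auto
    moreover have "1 / M \<le> q ^ 2"
    proof -
      have "1 * (2 * real p) \<le> 2 * pi * (r + \<theta>)"
        using r a pi_gt3 by (intro mult_mono) auto
      then have "1 * (2 * real p) / M \<le> q"
        unfolding q_def using M0 by (intro divide_right_mono) auto
      then have "(1 * (2 * real p) / M)\<^sup>2 \<le> q\<^sup>2" using M0 by (intro power_mono) auto
      moreover have "(1 * (2 * real p) / M)\<^sup>2 = 1 / M"
        using p by (simp add: Mp power2_eq_square)
      ultimately show ?thesis by simp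
    qed
    ultimately have den: "norm (cis q - 1) ^ 2 + 1 / M \<le> 2 * q ^ 2" by simp
    have "real M / 20 * (1 / (real r + 1)) \<le> real M / (2 * pi ^ 2 * (r + \<theta>))"
    proof -
      have "pi ^ 2 \<le> 3.15 ^ 2" using pi_approx by (intro power_mono) auto
      then have "pi ^ 2 \<le> 10" by (simp add: power2_eq_square)
      then have "2 * pi ^ 2 * (r + \<theta>) \<le> 20 * (real r + 1)"
        using a by (intro mult_mono) auto
      then have "real M / (20 * (real r + 1)) \<le> real M / (2 * pi ^ 2 * (r + \<theta>))"
        using r p a by (intro divide_left_mono mult_pos_pos add_pos_nonneg) auto
      then show ?thesis by simp
    qed
    also have "\<dots> = 1 / (pi * q)"
      by (simp add: q_def power2_eq_square)
    also have "\<dots> = (2 * q / pi) / (2 * q ^ 2)"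
      using q0 by (simp add: power2_eq_square)
    also have "\<dots> \<le> sin q / (norm (cis q - 1) ^ 2 + 1 / M)"
      using sin den q0 M0 by (intro frac_le) (auto intro!: add_nonneg_pos order_trans[OF _ sin])
    finally show ?thesis unfolding cis Im_reg_inv by simp
  qed
  show thesis
  proof
    show "a + 2 * p \<le> a + p\<^sup>2" using le by simp
    have "p\<^sup>2 \<le> M" by (simp add: M power_mult_distrib)
    then show "a + p\<^sup>2 \<le> 2 * M" using a by simp
    have "ln p - 2 \<le> ln (real (p\<^sup>2) + 1) - ln (real (2 * p) + 1)"
    proof -
      have "ln (real (2 * p) + 1) \<le> ln (3 * real p)" using p by (subst ln_le_cancel_iff) auto
      also have "\<dots> = ln 3 + ln p" using p by (subst ln_mult) auto
      also have "ln 3 \<le> (2::real)" using ln_le_minus_one[of 3] by simp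
      finally have "ln (real (2 * p) + 1) \<le> 2 + ln p" by simp
      moreover have "ln (real p ^ 2) \<le> ln (real (p\<^sup>2) + 1)" using p by (subst ln_le_cancel_iff) (auto intro: add_nonneg_pos)
      moreover have "ln (real p ^ 2) = 2 * ln p" using p by (simp add: ln_realpow)
      ultimately show ?thesis by linarith
    qed
    also have "\<dots> \<le> (\<Sum>r=2*p..<p\<^sup>2. 1 / (real r + 1))"
      by (rule sum_inverse_ge_ln[OF le])
    finally have "real M / 20 * (ln p - 2) \<le> real M / 20 * (\<Sum>r=2*p..<p\<^sup>2. 1 / (real r + 1))"
      by (intro mult_left_mono) auto
    also have "\<dots> \<le> (\<Sum>r=2*p..<p\<^sup>2. - Im (reg_inv (1 / M) (cis (2 * pi * real (a + r) / M) * z - 1)))"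
      unfolding sum_distrib_left by (intro sum_mono term_ge) auto
    also have "\<dots> = (\<Sum>k=a + 2 * p..<a + p\<^sup>2. - Im (reg_inv (1 / M) (cis (2 * pi * real k / M) * z - 1)))"
      using sum.shift_bounds_nat_ivl[of "\<lambda>k. - Im (reg_inv (1 / M) (cis (2 * pi * real k / M) * z - 1))" "2*p" a "p\<^sup>2"]
      by (simp add: add.commute)
    finally show "real M / 20 * (ln p - 2) \<le> (\<Sum>k=a + 2 * p..<a + p\<^sup>2. - Im (reg_inv (1 / M) (cis (2 * pi * real k / M) * z - 1)))" .
    fix k assume k: "k \<in> {a + 2 * p..<a + p\<^sup>2}"
    define r where "r = k - a"
    have r: "k = a + r" "2 * p \<le> r" "r < p\<^sup>2" using k by (auto simp: r_def)
    have "0 \<le> real M / 20 * (1 / (real r + 1))" by simp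
    with term_ge[OF r(2,3)]
    show "Im (reg_inv (1 / M) (cis (2 * pi * real k / M) * z - 1)) \<le> 0"
      unfolding r(1) by linarith
  qed
qed

section \<open>The chirp block\<close>

text \<open>The first column of the transfer matrix, for coefficients \<open>g k = F k * z ^ k\<close> on the circle.\<close>

fun su11_a su11_b :: "(nat \<Rightarrow> complex) \<Rightarrow> nat \<Rightarrow> complex" where
  "su11_a g 0 = 1"
| "su11_b g 0 = 0"
| "su11_a g (Suc k) = (su11_a g k + cnj (g k) * su11_b g k) / sqrt (1 - (norm (g k))\<^sup>2)"
| "su11_b g (Suc k) = (su11_b g k + g k * su11_a g k) / sqrt (1 - (norm (g k))\<^sup>2)"

text \<open>The form \<open>|a|^2 - |b|^2\<close> is the SU(1,1) invariant: an unnormalised step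
  multiplies it by \<open>1 - (norm (g k))\<^sup>2\<close>, and the square roots undo this.\<close>

lemma su11_norm_sq:
  assumes "\<And>k. norm (g k) < 1"
  shows "(norm (su11_a g k))\<^sup>2 = 1 + (norm (su11_b g k))\<^sup>2"
proof (induction k)
  case (Suc k)
  define a b h where "a = su11_a g k" and "b = su11_b g k" and "h = g k"
  have pos: "0 < 1 - (norm h)\<^sup>2"
    using assms[of k] by (simp add: h_def abs_square_less_1)
  have "complex_of_real ((norm (a + cnj h * b))\<^sup>2 - (norm (b + h * a))\<^sup>2) =
      of_real ((1 - (norm h)\<^sup>2) * ((norm a)\<^sup>2 - (norm b)\<^sup>2))"
    unfolding of_real_diff of_real_mult complex_norm_square by (simp add: algebra_simps)
  then have "(norm (a + cnj h * b))\<^sup>2 - (norm (b + h * a))\<^sup>2 = (1 - (norm h)\<^sup>2) * ((norm a)\<^sup>2 - (norm b)\<^sup>2)"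
    by (simp only: of_real_eq_iff)
  also have "\<dots> = 1 - (norm h)\<^sup>2" using Suc by (simp add: a_def b_def)
  finally have "(norm (a + cnj h * b))\<^sup>2 = (1 - (norm h)\<^sup>2) + (norm (b + h * a))\<^sup>2" by simp
  then have "(norm (a + cnj h * b))\<^sup>2 / (1 - (norm h)\<^sup>2) = 1 + (norm (b + h * a))\<^sup>2 / (1 - (norm h)\<^sup>2)"
    using pos by (simp add: field_simps)
  then show ?case using pos
    by (simp add: a_def[symmetric] b_def[symmetric] h_def[symmetric] norm_divide power_divide)
qed simp

lemma su11_norm_a_ge_1:
  assumes "\<And>k. norm (g k) < 1"
  shows "1 \<le> norm (su11_a g k)"
proof (rule power2_le_imp_le)
  show "1\<^sup>2 \<le> (norm (su11_a g k))\<^sup>2"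
    unfolding su11_norm_sq[OF assms] by simp
qed simp

lemma su11_norm_a_le:
  assumes "\<And>k. norm (g k) < 1"
  shows "norm (su11_a g k) \<le> 1 + norm (su11_b g k)"
proof (rule power2_le_imp_le)
  show "(norm (su11_a g k))\<^sup>2 \<le> (1 + norm (su11_b g k))\<^sup>2"
    unfolding su11_norm_sq[OF assms] power2_sum by simp
qed simp

section \<open>The quadratic phase and its approximate antiderivative\<close>

text \<open>With \<open>k * (k + 1)\<close> in the exponent rather than \<open>k^2\<close>, the
  quotient of the terms \<open>k + 1\<close> and \<open>k\<close> is exactly
  \<open>cis (2 * pi * (k + 1) / M)\<close>.\<close>

definition chirp :: "nat \<Rightarrow> nat \<Rightarrow> complex" where
  "chirp M k = cis (pi * (real k * (real k + 1)) / real M)"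

text \<open>The quotient of consecutive terms of \<open>chirp M k * z ^ k\<close>, namely the one
  leading into index \<open>k\<close>; resonance is the value 1.\<close>

definition phase :: "nat \<Rightarrow> complex \<Rightarrow> nat \<Rightarrow> complex" where
  "phase M z k = cis (2 * pi * real k / real M) * z"

lemma norm_phase_diff:
  assumes "norm z = 1"
  shows "norm (phase M z k - phase M z (Suc k)) \<le> 7 / M"
proof -
  have "phase M z (Suc k) = cis (2 * pi / M) * phase M z k"
    by (simp add: phase_def cis_mult mult.assoc[symmetric] add_divide_distrib ring_distribs)
  then have "phase M z (Suc k) - phase M z k = (cis (2 * pi / M) - 1) * phase M z k"
    by (simp add: algebra_simps)
  then have "norm (phase M z (Suc k) - phase M z k) = norm (cis (2 * pi / M) - 1)"
    using assms by (simp add: phase_def norm_mult)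
  also have "\<dots> \<le> 2 * pi / M" using norm_cis_minus_1_le[of "2 * pi / M"] by simp
  also have "\<dots> \<le> 7 / M" using pi_approx by (intro divide_right_mono) auto
  finally show ?thesis by (simp add: norm_minus_commute)
qed

lemma chirp_Suc: "chirp M (Suc k) * z ^ Suc k = phase M z (Suc k) * (chirp M k * z ^ k)"
proof -
  have "chirp M (Suc k) = cis (2 * pi * real (Suc k) / real M) * chirp M k"
    by (simp add: chirp_def cis_mult add_divide_distrib[symmetric] algebra_simps)
  then show ?thesis by (simp add: phase_def)
qed

text \<open>Were the frequency constant, \<open>w k / (phase - 1)\<close> would be an exact antiderivative of \<open>w\<close>.\<close>

definition corrector :: "nat \<Rightarrow> complex \<Rightarrow> nat \<Rightarrow> complex" where
  "corrector M z k = chirp M k * z ^ k * reg_inv (1 / M) (phase M z k - 1)"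

lemma norm_chirp: "norm z = 1 \<Longrightarrow> norm (chirp M k * z ^ k) = 1"
  by (simp add: chirp_def norm_mult norm_power)

lemma norm_corrector_le:
  "norm z = 1 \<Longrightarrow> 0 < M \<Longrightarrow> norm (corrector M z k) \<le> reg_abs (1 / M) (phase M z k - 1)"
  using norm_reg_inv_le[of "1 / real M" "phase M z k - 1"] norm_chirp[of z M k]
  by (simp add: corrector_def norm_mult)

text \<open>The defect has two sources: smoothing, through \<open>1 - x * reg_inv t x\<close>, and
  the change of frequency in one step, through the increment of \<open>reg_inv\<close>. Both are of
  order \<open>1 / M\<close> times squares of \<open>reg_abs\<close>.\<close>

lemma norm_corrector_error_le:
  assumes "norm z = 1" "0 < M"
  shows "norm (chirp M k * z ^ k - (corrector M z (Suc k) - corrector M z k))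
    \<le> 9 / (2 * M) * reg_abs (1 / M) (phase M z (Suc k) - 1) ^ 2
      + 7 / (2 * M) * reg_abs (1 / M) (phase M z k - 1) ^ 2"
proof -
  define \<zeta> \<zeta>' T T' Y Y' where "\<zeta> = phase M z k" and "\<zeta>' = phase M z (Suc k)"
    and "T = reg_inv (1 / M) (\<zeta> - 1)" and "T' = reg_inv (1 / M) (\<zeta>' - 1)"
    and "Y = reg_abs (1 / M) (\<zeta> - 1)" and "Y' = reg_abs (1 / M) (\<zeta>' - 1)"
  have Y: "0 < Y" "0 < Y'" using assms by (auto simp: Y_def Y'_def intro!: reg_abs_pos)
  have "chirp M k * z ^ k - (corrector M z (Suc k) - corrector M z k) =
      chirp M k * z ^ k * ((1 - (\<zeta>' - 1) * T') + (T - T'))"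
    unfolding corrector_def chirp_Suc
    by (simp add: \<zeta>_def[symmetric] \<zeta>'_def[symmetric] T_def[symmetric] T'_def[symmetric] algebra_simps)
  then have "norm (chirp M k * z ^ k - (corrector M z (Suc k) - corrector M z k)) =
      norm ((1 - (\<zeta>' - 1) * T') + (T - T'))"
    using norm_chirp[OF assms(1)] by (simp add: norm_mult)
  also have "\<dots> \<le> norm (1 - (\<zeta>' - 1) * T') + norm (T - T')" by (rule norm_triangle_ineq)
  also have "norm (1 - (\<zeta>' - 1) * T') = 1 / M * Y' ^ 2"
    unfolding T'_def Y'_def using assms by (intro one_minus_mult_reg_inv) auto
  also have "norm (T - T') \<le> norm ((\<zeta> - 1) - (\<zeta>' - 1)) * (Y * Y')"
    unfolding T_def T'_def Y_def Y'_def using assms by (intro norm_reg_inv_diff) auto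
  also have "\<dots> \<le> 7 / M * ((Y ^ 2 + Y' ^ 2) / 2)"
    using norm_phase_diff[OF assms(1), of M k] Y sum_squares_bound[of Y Y']
    by (intro mult_mono) (auto simp: \<zeta>_def \<zeta>'_def)
  also have "1 / M * Y' ^ 2 + 7 / M * ((Y ^ 2 + Y' ^ 2) / 2) = 9 / (2 * M) * Y' ^ 2 + 7 / (2 * M) * Y ^ 2"
    using assms by (simp add: field_simps)
  finally show ?thesis by (simp add: Y_def Y'_def \<zeta>_def \<zeta>'_def)
qed

lemma sum_phase_shift:
  fixes f :: "complex \<Rightarrow> real"
  assumes "0 < M"
  shows "(\<Sum>k<2 * M. f (phase M z (Suc k))) = (\<Sum>k<2 * M. f (phase M z k))"
proof -
  have "phase M z (M + k) = phase M z k" for k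
    using cis_shift_period[OF assms, of k] by (simp add: phase_def)
  then have "phase M z (2 * M + k) = phase M z k" for k
    by (metis add.assoc mult_2)
  then show ?thesis
    using sum_periodic_shift[of "\<lambda>k. f (phase M z k)" "2 * M" 1] by simp
qed

text \<open>These serve as \<open>A\<close>, \<open>B\<close> and \<open>E\<close> of the averaging
  system. With \<open>\<epsilon> = \<eta> / (2 * p)\<close> the products
  \<open>\<epsilon> * A\<close> and \<open>\<epsilon> * E\<close> are multiples of \<eta>, whereas
  \<open>\<epsilon>\<^sup>2 * B\<close> is a multiple of \<open>\<eta>\<^sup>2 * ln p\<close>: only
  this one survives as \<eta> shrinks.\<close>

lemma corrector_bounds:
  fixes p M :: nat
  assumes z: "norm z = 1" and p: "2 \<le> p" and l: "4 \<le> ln p" and M: "M = (2 * p)\<^sup>2"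
  shows "norm (corrector M z k) \<le> 2 * p"
    and "(\<Sum>k<2 * M. norm (corrector M z (Suc k))) \<le> 3 * M * ln p"
    and "(\<Sum>k<2 * M. norm (chirp M k * z ^ k - (corrector M z (Suc k) - corrector M z k))) \<le> 256 * p"
proof -
  have M0: "0 < M" using p by (simp add: M)
  have Mp: "real M = 4 * real p ^ 2" by (simp add: M power_mult_distrib)
  define Y where "Y k = reg_abs (1 / M) (phase M z k - 1)" for k
  have Y2: "(\<Sum>k<2 * M. Y k ^ 2) \<le> 32 * real M * p"
    using sum_reg_abs_power_le[OF z M0, of 2] sum_peak_sq_le[of "2 * p" M] p
    by (simp add: Y_def phase_def M)
  have Y1: "(\<Sum>k<2 * M. Y k) \<le> 3 * M * ln p"
  proof -
    have "(\<Sum>k<2 * M. Y k) \<le> 4 * (2 * p + M / 4 * (1 + 2 * ln (2 * p)))"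
      using sum_reg_abs_power_le[OF z M0, of 1] sum_peak_le[of "2 * p" M] p
      by (simp add: Y_def phase_def M)
    also have "\<dots> = 8 * real p + real M * (1 + 2 * ln (2 * real p))" by (simp add: algebra_simps)
    also have "\<dots> \<le> real M + real M * (3 + 2 * ln p)"
    proof (rule add_mono)
      show "8 * real p \<le> real M" using p by (simp add: Mp power2_eq_square)
      show "real M * (1 + 2 * ln (2 * real p)) \<le> real M * (3 + 2 * ln p)"
        using p ln_le_minus_one[of 2] by (intro mult_left_mono) (auto simp: ln_mult)
    qed
    also have "\<dots> = real M * (4 + 2 * ln p)" by (simp add: algebra_simps)
    also have "\<dots> \<le> real M * (3 * ln p)" using l by (intro mult_left_mono) auto
    finally show ?thesis by simp
  qed
  show "norm (corrector M z k) \<le> 2 * p"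
  proof -
    have "sqrt (real M) = 2 * p" unfolding M of_nat_power real_sqrt_abs by simp
    then show ?thesis
      using norm_corrector_le[OF z M0, of k] reg_abs_le[of "1 / real M" "phase M z k - 1"] M0
      by (simp add: real_sqrt_divide)
  qed
  show "(\<Sum>k<2 * M. norm (corrector M z (Suc k))) \<le> 3 * M * ln p"
  proof -
    have "(\<Sum>k<2 * M. norm (corrector M z (Suc k))) \<le> (\<Sum>k<2 * M. Y (Suc k))"
      unfolding Y_def by (intro sum_mono norm_corrector_le z M0)
    also have "\<dots> = (\<Sum>k<2 * M. Y k)"
      unfolding Y_def by (rule sum_phase_shift[OF M0])
    finally show ?thesis using Y1 by linarith
  qed
  have "(\<Sum>k<2 * M. norm (chirp M k * z ^ k - (corrector M z (Suc k) - corrector M z k)))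
     \<le> (\<Sum>k<2 * M. 9 / (2 * real M) * Y (Suc k) ^ 2 + 7 / (2 * real M) * Y k ^ 2)"
    unfolding Y_def by (intro sum_mono norm_corrector_error_le z M0)
  also have "\<dots> = 9 / (2 * real M) * (\<Sum>k<2 * M. Y (Suc k) ^ 2) + 7 / (2 * real M) * (\<Sum>k<2 * M. Y k ^ 2)"
    by (simp add: sum.distrib sum_distrib_left)
  also have "(\<Sum>k<2 * M. Y (Suc k) ^ 2) = (\<Sum>k<2 * M. Y k ^ 2)"
    unfolding Y_def by (rule sum_phase_shift[OF M0])
  also have "9 / (2 * real M) * (\<Sum>k<2 * M. Y k ^ 2) + 7 / (2 * real M) * (\<Sum>k<2 * M. Y k ^ 2) =
      8 / M * (\<Sum>k<2 * M. Y k ^ 2)" by (simp add: field_simps)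
  also have "\<dots> \<le> 8 / M * (32 * real M * p)" by (intro mult_left_mono Y2) auto
  also have "\<dots> = 256 * p" using M0 by simp
  finally show "(\<Sum>k<2 * M. norm (chirp M k * z ^ k - (corrector M z (Suc k) - corrector M z k))) \<le> 256 * p" .
qed

section \<open>Small blocks with a rotation of fixed size\<close>

text \<open>The choice of \<eta> fixes \<open>\<eta>\<^sup>2 * ln p = 160\<close>, so the
  accumulated rotation keeps its size however small \<eta> is. If \<open>u\<close> stayed within
  \<open>1/2\<close> of 1, the drift over the window after resonance would be at most
  \<open>3/2\<close> and yet at least nearly 4.\<close>

lemma chirp_rotation:
  fixes p M :: nat and \<eta> C :: real
  defines "M \<equiv> (2 * p)\<^sup>2" and "\<eta> \<equiv> sqrt (160 / ln p)" and "C \<equiv> 260 * exp 1216"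
  defines "g \<equiv> \<lambda>z k. of_real (\<eta> / (2 * p)) * chirp M k * z ^ k"
  assumes z: "norm z = 1" and p: "3 \<le> p" and \<eta>: "\<eta> \<le> 1 / 4000" and C: "C * \<eta> \<le> 1 / 2"
    and l: "4 \<le> ln p"
  shows "\<And>k. k \<le> 2 * M \<Longrightarrow> norm (su11_b (g z) k) \<le> 2 * (C * \<eta>)"
    and "\<exists>k\<le>2 * M. 1 / 4 \<le> norm (su11_a (g z) k - 1)"
proof -
  define \<epsilon> where "\<epsilon> = \<eta> / (2 * p)"
  define c where "c = sqrt (1 - \<epsilon>\<^sup>2)"
  define w where "w k = chirp M k * z ^ k" for k
  \<comment> \<open>Every coefficient has modulus \<epsilon>, so multiplying by \<open>c ^ k\<close>
    removes all the normalising square roots at once; \<open>ck_ge\<close> shows that this factor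
    stays near 1 along the block.\<close>
  define u v where "u k = of_real (c ^ k) * su11_a (g z) k" and "v k = of_real (c ^ k) * su11_b (g z) k" for k
  have M0: "0 < M" using p by (simp add: M_def)
  have Mp: "real M = 4 * real p ^ 2" by (simp add: M_def power_mult_distrib)
  have \<eta>0: "0 < \<eta>" using l by (simp add: \<eta>_def)
  have \<eta>sq: "\<eta>\<^sup>2 * ln p = 160" using l by (simp add: \<eta>_def)
  have \<epsilon>0: "0 < \<epsilon>" using \<eta>0 p by (simp add: \<epsilon>_def)
  have \<epsilon>p: "\<epsilon> * (2 * p) = \<eta>" using p by (simp add: \<epsilon>_def)
  have \<epsilon>M: "\<epsilon>\<^sup>2 * M = \<eta>\<^sup>2" using p by (simp add: \<epsilon>_def Mp power_divide power_mult_distrib)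
  have \<epsilon>\<eta>: "\<epsilon> \<le> \<eta>" using p \<eta>0 by (simp add: \<epsilon>_def divide_le_eq)
  have \<epsilon>1: "\<epsilon> < 1" using \<epsilon>\<eta> \<eta> by linarith
  have \<eta>2: "\<eta>\<^sup>2 \<le> 1 / 16"
    using power_mono[OF \<eta>, of 2] \<eta>0 by (simp add: power_divide)
  have g: "g z k = \<epsilon> * w k" for k by (simp add: g_def \<epsilon>_def w_def)
  have w: "norm (w k) = 1" for k unfolding w_def by (rule norm_chirp[OF z])
  have norm_g: "norm (g z k) = \<epsilon>" for k using \<epsilon>0 w by (simp add: g norm_mult)
  then have g1: "\<And>k. norm (g z k) < 1" using \<epsilon>1 by simp
  have \<epsilon>sq: "0 < 1 - \<epsilon>\<^sup>2" "\<epsilon>\<^sup>2 < 1" using \<epsilon>0 \<epsilon>1 by (simp_all add: abs_square_less_1)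
  have c: "0 < c" "c \<le> 1" using \<epsilon>sq by (auto simp: c_def)
  have ck: "0 < c ^ k" "c ^ k \<le> 1" for k using c by (auto intro: power_le_one)
  have ck_ge: "1 - 2 * \<eta>\<^sup>2 \<le> c ^ k" if "k \<le> 2 * M" for k
  proof -
    have "1 - real k * \<epsilon>\<^sup>2 \<le> (1 - \<epsilon>\<^sup>2) ^ k"
      using Bernoulli_inequality[of "- \<epsilon>\<^sup>2" k] \<epsilon>sq by simp
    also have "\<dots> = c ^ k * c ^ k" using \<epsilon>sq by (simp add: c_def flip: power_mult_distrib)
    also have "\<dots> \<le> c ^ k" using ck[of k] by simp
    finally have "1 - real k * \<epsilon>\<^sup>2 \<le> c ^ k" .
    moreover have "real k * \<epsilon>\<^sup>2 \<le> real (2 * M) * \<epsilon>\<^sup>2"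
      using that by (intro mult_right_mono) (auto simp del: of_nat_mult)
    moreover have "real (2 * M) * \<epsilon>\<^sup>2 = 2 * \<eta>\<^sup>2" using \<epsilon>M by (simp add: mult.commute)
    ultimately show ?thesis by linarith
  qed
  have u_le: "norm (u k) \<le> 1 + norm (v k)" for k
  proof -
    have "c ^ k * norm (su11_a (g z) k) \<le> c ^ k * (1 + norm (su11_b (g z) k))"
      using ck[of k] by (intro mult_left_mono su11_norm_a_le g1) auto
    then show ?thesis using ck[of k] c by (simp add: u_def v_def norm_mult norm_power algebra_simps)
  qed
  have u_Suc: "u (Suc k) = u k + \<epsilon> * cnj (w k) * v k" and v_Suc: "v (Suc k) = v k + \<epsilon> * w k * u k" for k
    using c norm_g[of k] by (simp_all add: u_def v_def flip: c_def) (simp_all add: g field_simps)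
  have p2: "2 \<le> p" using p by simp
  have Meq: "M = (2 * p)\<^sup>2" by (simp add: M_def)
  note cb = corrector_bounds[OF z p2 l Meq]
  interpret unnormalised_system \<epsilon> w u v "corrector M z" "real (2 * p)" "3 * M * ln p" "real (256 * p)" "2 * M"
  proof
    show "\<epsilon> * real (2 * p) \<le> 1 / 2" using \<epsilon>p \<eta> by simp
  qed (use \<epsilon>0 w u_Suc v_Suc u_le cb in \<open>simp_all add: w_def u_def v_def\<close>)
  have E: "\<epsilon> * real (256 * p) = 128 * \<eta>" using \<epsilon>p by simp
  have A: "\<epsilon> * real (2 * p) = \<eta>" using \<epsilon>p by simp
  have B: "\<epsilon>\<^sup>2 * (3 * M * ln p) = 480"
  proof -
    have "\<epsilon>\<^sup>2 * (3 * M * ln p) = 3 * (\<epsilon>\<^sup>2 * M * ln p)" by simp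
    then show ?thesis by (simp add: \<epsilon>M \<eta>sq)
  qed
  \<comment> \<open>\<open>260 = 2 * (2 + 128)\<close>, and the exponent
    \<open>2 * (128 * \<eta> + 480)\<close> stays below 1216 since \<eta> \<le> 1.\<close>
  have V: "V \<le> C * \<eta>"
  proof -
    have "exp (2 * (128 * \<eta> + 480)) \<le> exp (1216 :: real)" using \<eta> by simp
    then have "260 * \<eta> * exp (2 * (128 * \<eta> + 480)) \<le> 260 * \<eta> * exp 1216"
      using \<eta>0 by (intro mult_left_mono) auto
    then show ?thesis unfolding V_def A B E by (simp add: C_def algebra_simps)
  qed
  have V_half: "V \<le> 1 / 2" using V C by linarith
  have ck_half: "1 / 2 \<le> c ^ k" if "k \<le> 2 * M" for k
    using ck_ge[OF that] \<eta>2 by linarith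
  show "norm (su11_b (g z) k) \<le> 2 * (C * \<eta>)" if "k \<le> 2 * M" for k
  proof -
    have "1 / 2 * norm (su11_b (g z) k) \<le> c ^ k * norm (su11_b (g z) k)"
      by (intro mult_right_mono ck_half that) auto
    also have "\<dots> = norm (v k)" using c by (simp add: v_def norm_mult norm_power)
    also have "\<dots> \<le> C * \<eta>" using norm_v_le[OF that] V by linarith
    finally show ?thesis by simp
  qed
  have "\<exists>k\<le>2 * M. 1 / 2 < norm (u k - 1)"
  proof (rule ccontr)
    assume "\<not> (\<exists>k\<le>2 * M. 1 / 2 < norm (u k - 1))"
    then have near: "norm (u k - 1) \<le> 1 / 2" if "k \<le> 2 * M" for k
      using that by force
    define T where "T k = reg_inv (1 / M) (phase M z k - 1)" for k
    obtain a where a: "a + 2 * p \<le> a + p\<^sup>2" "a + p\<^sup>2 \<le> 2 * M"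
      "real M / 20 * (ln p - 2) \<le> (\<Sum>k=a + 2 * p..<a + p\<^sup>2. - Im (T k))"
      "\<And>k. k \<in> {a + 2 * p..<a + p\<^sup>2} \<Longrightarrow> Im (T k) \<le> 0"
      using sum_Im_reg_inv_ge[OF z p Meq] unfolding T_def phase_def by metis
    define S where "S = (\<Sum>k=a + 2 * p..<a + p\<^sup>2. T k * u k)"
    \<comment> \<open>The oscillation cancels here: the rate of rotation is the smoothed reciprocal
      alone.\<close>
    have wP: "cnj (w k) * corrector M z k = T k" for k
    proof -
      have "cnj (w k) * w k = 1"
        using w[of k] by (simp add: mult.commute flip: complex_norm_square)
      then show ?thesis
        by (simp add: corrector_def T_def mult.assoc[symmetric] flip: w_def)
    qed
    have W: "W \<le> 1"
    proof -
      have "\<eta> * (1 + V) \<le> 1 / 4 * 2" using \<eta> \<eta>0 V_half V_nonneg by (intro mult_mono) auto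
      then show ?thesis unfolding W_def A using V_half by simp
    qed
    have "norm (u (a + p\<^sup>2) - u (a + 2 * p) - \<epsilon>\<^sup>2 * S)
      \<le> (2 * \<eta> + 128 * \<eta>) * W + \<eta> * (128 * \<eta> * (1 + V) + 480 * V)"
      using u_drift[OF a(1,2)] unfolding A B E wP S_def .
    also have "\<dots> \<le> (2 * \<eta> + 128 * \<eta>) * 1 + \<eta> * (128 * 1 * (1 + 1) + 480 * 1)"
      using W W_nonneg \<eta> \<eta>0 V_half V_nonneg by (intro add_mono mult_mono) auto
    also have "\<dots> \<le> 1 / 2" using \<eta> by simp
    finally have drift: "norm (u (a + p\<^sup>2) - u (a + 2 * p) - \<epsilon>\<^sup>2 * S) \<le> 1 / 2" .
    have "norm (\<epsilon>\<^sup>2 * S) \<le> norm (u (a + p\<^sup>2) - u (a + 2 * p) - \<epsilon>\<^sup>2 * S)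
        + norm (u (a + p\<^sup>2) - 1) + norm (u (a + 2 * p) - 1)" by norm
    also have "\<dots> \<le> 1 / 2 + 1 / 2 + 1 / 2"
      using a by (intro add_mono drift near) auto
    finally have "norm (\<epsilon>\<^sup>2 * S) \<le> 3 / 2" by simp
    then have upper: "\<epsilon>\<^sup>2 * norm S \<le> 3 / 2" by (simp add: norm_mult norm_power)
    \<comment> \<open>In \<open>Im (T k * u k)\<close> the part with \<open>Im (T k)\<close> keeps
      its sign because \<open>Re (u k) \<ge> 1/2\<close>. The cross term costs at most
      \<open>1/4\<close> per step, in total at most \<open>p^2 / 4 = M / 16\<close>.\<close>
    have term_ge: "- Im (T k) / 2 - 1 / 4 \<le> - Im (T k * u k)" if k: "k \<in> {a + 2 * p..<a + p\<^sup>2}" for k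
    proof -
      have nk: "norm (u k - 1) \<le> 1 / 2" using k a by (intro near) auto
      have "\<bar>Im (u k)\<bar> \<le> 1 / 2" using abs_Im_le_cmod[of "u k - 1"] nk by simp
      have "1 / 2 \<le> Re (u k)" using abs_Re_le_cmod[of "u k - 1"] nk by simp
      then have "- Im (T k) * (1 / 2) \<le> - Im (T k) * Re (u k)"
        using a(4)[OF k] by (intro mult_left_mono) auto
      moreover have "\<bar>Re (T k) * Im (u k)\<bar> \<le> 1 / 2 * (1 / 2)"
      proof -
        have "z = cis (Arg z)" using rcis_cmod_Arg[of z] z by (simp add: rcis_def)
        then obtain q where "phase M z k = cis q" by (metis phase_def cis_mult)
        then have "\<bar>Re (T k)\<bar> \<le> 1 / 2" using abs_Re_reg_inv[of "1 / real M" q] M0 by (simp add: T_def)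
        then show ?thesis unfolding abs_mult using \<open>\<bar>Im (u k)\<bar> \<le> 1 / 2\<close> by (intro mult_mono) auto
      qed
      ultimately show ?thesis by simp
    qed
    have "real M / 40 * (ln p - 2) - M / 16 \<le>
        (\<Sum>k=a + 2 * p..<a + p\<^sup>2. - Im (T k)) / 2 - p\<^sup>2 / 4"
      using a(3) by (simp add: Mp)
    also have "\<dots> \<le> (\<Sum>k=a + 2 * p..<a + p\<^sup>2. - Im (T k) / 2 - 1 / 4)"
      by (simp add: sum_subtractf sum_negf of_nat_diff flip: sum_divide_distrib)
    also have "\<dots> \<le> (\<Sum>k=a + 2 * p..<a + p\<^sup>2. - Im (T k * u k))"
      by (intro sum_mono term_ge)
    also have "\<dots> = - Im S" by (simp only: S_def Im_sum sum_negf)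
    also have "\<dots> \<le> norm S" using abs_Im_le_cmod[of S] by linarith
    finally have "\<epsilon>\<^sup>2 * (real M / 40 * (ln p - 2) - M / 16) \<le> \<epsilon>\<^sup>2 * norm S"
      by (intro mult_left_mono) auto
    \<comment> \<open>The leading part is \<open>160 / 40 = 4\<close>, against the upper bound
      \<open>3/2\<close>.\<close>
    moreover have "\<epsilon>\<^sup>2 * (real M / 40 * (ln p - 2) - M / 16) = \<eta>\<^sup>2 * ln p / 40 - \<eta>\<^sup>2 / 20 - \<eta>\<^sup>2 / 16"
      unfolding \<epsilon>M[symmetric] by (simp add: field_simps)
    ultimately show False using upper \<eta>2 \<eta>sq by linarith
  qed
  then obtain k where k: "k \<le> 2 * M" "1 / 2 < norm (u k - 1)" by blast
  \<comment> \<open>Undoing the factor \<open>c ^ k\<close> costs at most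
    \<open>2 * \<eta>\<^sup>2 \<le> 1/8\<close>.\<close>
  have "1 / 4 \<le> norm (su11_a (g z) k - 1)"
  proof -
    have "u k - 1 = of_real (c ^ k) * (su11_a (g z) k - 1) - of_real (1 - c ^ k)"
      by (simp add: u_def algebra_simps)
    then have "norm (u k - 1) \<le> norm (of_real (c ^ k) * (su11_a (g z) k - 1)) + norm (of_real (1 - c ^ k) :: complex)"
      by (metis norm_triangle_ineq4)
    also have "\<dots> = c ^ k * norm (su11_a (g z) k - 1) + (1 - c ^ k)"
      unfolding norm_mult norm_of_real using ck[of k] by simp
    also have "c ^ k * norm (su11_a (g z) k - 1) \<le> 1 * norm (su11_a (g z) k - 1)"
      by (intro mult_right_mono ck) auto
    finally show ?thesis using k ck_ge[OF k(1)] \<eta>2 by linarith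
  qed
  with k show "\<exists>k\<le>2 * M. 1 / 4 \<le> norm (su11_a (g z) k - 1)" by blast
qed

text \<open>The rotation depends on \<open>\<eta>\<^sup>2 * ln p\<close>, while the smallness bounds
  are at most multiples of \<eta>, so a large \<open>p\<close> achieves any \<delta>. One block
  serves every \<open>z\<close>: only the time of resonance depends on \<open>z\<close>.\<close>

lemma rotating_block:
  assumes "0 < (\<delta>::real)"
  obtains L :: nat and G :: "nat \<Rightarrow> complex" where
    "\<And>k. norm (G k) < 1" "(\<Sum>k<L. (norm (G k))\<^sup>2) \<le> \<delta>"
    "\<And>z k. norm z = 1 \<Longrightarrow> k \<le> L \<Longrightarrow> norm (su11_b (\<lambda>k. G k * z ^ k) k) \<le> \<delta>"
    "\<And>z. norm z = 1 \<Longrightarrow> \<exists>k\<le>L. 1 / 4 \<le> norm (su11_a (\<lambda>k. G k * z ^ k) k - 1)"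
proof -
  define C :: real where "C = 260 * exp 1216"
  have C: "260 \<le> C" by (simp add: C_def)
  \<comment> \<open>An upper bound for \<eta>: the three entries secure \<eta> \<le> 1/4000,
    \<open>C * \<eta> \<le> 1/2\<close> and \<open>2 * (C * \<eta>) \<le> \<delta>\<close>.\<close>
  define h where "h = min (1 / 4000) (min (1 / (2 * C)) (\<delta> / (2 * C)))"
  have h: "0 < h" "h \<le> 1 / 4000" "h \<le> 1 / (2 * C)" "h \<le> \<delta> / (2 * C)"
    unfolding h_def using C assms by (simp_all only: min.cobounded1 min.cobounded2 min.coboundedI2) auto
  \<comment> \<open>This gives \<open>ln p \<ge> 160 / h\<^sup>2\<close>, which amounts to
    \<open>\<eta> \<le> h\<close>.\<close>
  define p where "p = nat \<lceil>exp (160 / h\<^sup>2)\<rceil>"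
  have p_ge: "exp (160 / h\<^sup>2) \<le> p" unfolding p_def by linarith
  have "h\<^sup>2 \<le> 1\<^sup>2" using h by (intro power_mono) auto
  then have big: "160 \<le> 160 / h\<^sup>2" using h by (simp add: field_simps)
  have p0: "0 < real p" using p_ge less_le_trans[OF exp_gt_zero] by blast
  have ln_p: "160 / h\<^sup>2 \<le> ln p" using p_ge p0 by (simp add: ln_ge_iff)
  define \<eta> where "\<eta> = sqrt (160 / ln p)"
  have lp0: "0 < ln (real p)" using ln_p big by linarith
  have "160 / ln p \<le> h\<^sup>2"
    using ln_p lp0 h by (simp add: divide_le_eq mult.commute)
  then have \<eta>h: "\<eta> \<le> h" unfolding \<eta>_def using h by (intro real_le_lsqrt) auto
  have \<eta>0: "0 < \<eta>" using ln_p big by (simp add: \<eta>_def)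
  have p3: "3 \<le> p"
  proof -
    have "1 + 160 \<le> exp (160::real)" by (rule exp_ge_add_one_self)
    also have "\<dots> \<le> exp (160 / h\<^sup>2)" using big by simp
    finally show ?thesis using p_ge by linarith
  qed
  have C\<eta>: "C * \<eta> \<le> 1 / 2" "2 * (C * \<eta>) \<le> \<delta>"
    using h \<eta>h C order_trans[OF \<eta>h h(3)] order_trans[OF \<eta>h h(4)] by (simp_all add: field_simps)
  define M where "M = (2 * p)\<^sup>2"
  define G where "G k = of_real (\<eta> / (2 * p)) * chirp M k" for k
  have nG: "norm (G k) = \<eta> / (2 * p)" for k
    using \<eta>0 by (simp add: G_def norm_mult chirp_def norm_divide)
  note rot = chirp_rotation[OF _ p3, folded \<eta>_def C_def M_def, folded G_def]
  have l: "4 \<le> ln p" and \<eta>': "\<eta> \<le> 1 / 4000" using ln_p big \<eta>h h by linarith+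
  show thesis
  proof
    show "norm (G k) < 1" for k
      unfolding nG using p3 \<eta>' \<eta>0 by (simp add: divide_less_eq)
    have "(\<Sum>k<2 * M. (norm (G k))\<^sup>2) = 2 * \<eta>\<^sup>2"
      using p3 by (simp add: nG M_def power_divide power_mult_distrib)
    also have "\<dots> \<le> 2 * (1 * \<eta>)"
      unfolding power2_eq_square using \<eta>' \<eta>0 by (intro mult_left_mono mult_right_mono) auto
    also have "\<dots> \<le> 2 * (C * \<eta>)" using C \<eta>0 by (intro mult_left_mono mult_right_mono) auto
    finally show "(\<Sum>k<2 * M. (norm (G k))\<^sup>2) \<le> \<delta>" using C\<eta> by linarith
    show "norm (su11_b (\<lambda>k. G k * z ^ k) k) \<le> \<delta>" if "norm z = 1" "k \<le> 2 * M" for z k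
      using rot(1)[OF that(1) \<eta>' C\<eta>(1) l that(2)] C\<eta>(2) by linarith
    show "\<exists>k\<le>2 * M. 1 / 4 \<le> norm (su11_a (\<lambda>k. G k * z ^ k) k - 1)" if "norm z = 1" for z
      using rot(2)[OF that(1) \<eta>' C\<eta>(1) l] .
  qed
qed

section \<open>Concatenation of blocks\<close>

text \<open>Transfer matrices multiply, and an SU(1,1) matrix is determined by its first column. A
  unimodular factor on the coefficients, as produced by shifting a block, multiplies
  \<open>su11_b\<close> by that factor and leaves \<open>su11_a\<close> unchanged.\<close>

lemma su11_concat:
  assumes h: "\<And>k. k < L \<Longrightarrow> g (s + k) = c * h k" and c: "norm c = 1" and "k \<le> L"
  shows "su11_a g (s + k) = su11_a h k * su11_a g s + cnj (c * su11_b h k) * su11_b g s"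
    and "su11_b g (s + k) = c * su11_b h k * su11_a g s + cnj (su11_a h k) * su11_b g s"
proof -
  have cc: "c * cnj c = 1" "cnj c * c = 1"
    unfolding mult.commute[of "cnj c"] complex_norm_square[symmetric] c by simp_all
  have "su11_a g (s + k) = su11_a h k * su11_a g s + cnj (c * su11_b h k) * su11_b g s \<and>
      su11_b g (s + k) = c * su11_b h k * su11_a g s + cnj (su11_a h k) * su11_b g s"
    using \<open>k \<le> L\<close>
  proof (induction k)
    case (Suc k)
    define r where "r = complex_of_real (sqrt (1 - (norm (h k))\<^sup>2))"
    define a b \<alpha> \<beta> where "a = su11_a g s" and "b = su11_b g s" and "\<alpha> = su11_a h k" and "\<beta> = su11_b h k"
    have r: "complex_of_real (sqrt (1 - (norm (g (s + k)))\<^sup>2)) = r" "cnj r = r"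
      using h[of k] Suc.prems c by (simp_all add: r_def norm_mult)
    have g: "g (s + k) = c * h k" using h Suc.prems by simp
    have IH: "su11_a g (s + k) = \<alpha> * a + cnj (c * \<beta>) * b" "su11_b g (s + k) = c * \<beta> * a + cnj \<alpha> * b"
      using Suc by (simp_all add: a_def b_def \<alpha>_def \<beta>_def)
    have "\<alpha> * a + cnj (c * \<beta>) * b + cnj (c * h k) * (c * \<beta> * a + cnj \<alpha> * b) =
        (\<alpha> + (c * cnj c) * cnj (h k) * \<beta>) * a + cnj (c * (\<beta> + h k * \<alpha>)) * b"
      by (simp add: algebra_simps)
    moreover have "c * \<beta> * a + cnj \<alpha> * b + c * h k * (\<alpha> * a + cnj (c * \<beta>) * b) =
        c * (\<beta> + h k * \<alpha>) * a + cnj (\<alpha> + (c * cnj c) * cnj (h k) * \<beta>) * b"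
      using cc by (simp add: algebra_simps)
    ultimately show ?case
      by (simp add: IH r flip: a_def b_def \<alpha>_def \<beta>_def r_def) (simp add: g cc add_divide_distrib)
  qed simp
  then show "su11_a g (s + k) = su11_a h k * su11_a g s + cnj (c * su11_b h k) * su11_b g s"
    and "su11_b g (s + k) = c * su11_b h k * su11_a g s + cnj (su11_a h k) * su11_b g s" by blast+
qed

section \<open>From the transfer matrix to the recursion for its first column\<close>

lemma su11_eventually_zero:
  assumes "\<And>k. K \<le> k \<Longrightarrow> g k = 0" "K \<le> n"
  shows "su11_a g n = su11_a g K" "su11_b g n = su11_b g K"
  using assms(2) by (induction n rule: dec_induct) (auto simp: assms(1))

lemma su11_cong:
  assumes "\<And>k. k < n \<Longrightarrow> g k = h k"
  shows "su11_a g n = su11_a h n" "su11_b g n = su11_b h n"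
proof -
  have "su11_a g k = su11_a h k \<and> su11_b g k = su11_b h k" if "k \<le> n" for k
    using that by (induction k) (auto simp: assms)
  then show "su11_a g n = su11_a h n" "su11_b g n = su11_b h n" by auto
qed

lemma powi_minus_unit:
  assumes "norm z = 1"
  shows "z powi (- int k) = cnj (z ^ k)"
proof -
  have "z ^ k * cnj (z ^ k) = 1"
    unfolding complex_norm_square[symmetric] by (simp add: norm_power assms)
  then have "inverse (z ^ k) = cnj (z ^ k)" by (rule inverse_unique)
  then show ?thesis by (simp add: power_int_minus)
qed

lemma nlft_transfer_add:
  "nlft_transfer G z lo (j + k) = nlft_transfer G z (lo + int j) k ** nlft_transfer G z lo j"
  by (induction k) (simp_all add: matrix_mul_assoc add.assoc)

lemma mat2_id: "mat2 1 0 0 1 = mat 1"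
  by (simp add: mat2_def vec_eq_iff forall_2 mat_def)

lemma nlft_transfer_trivial:
  "(\<And>j. j < k \<Longrightarrow> G (lo + int j) = 0) \<Longrightarrow> nlft_transfer G z lo k = mat 1"
  by (induction k) (simp_all add: nlft_step_def mat2_id)

lemma nlft_transfer_column:
  assumes "norm z = 1"
  shows "nlft_transfer G z 0 k $ 1 $ 1 = su11_a (\<lambda>k. G (int k) * z ^ k) k"
    and "nlft_transfer G z 0 k $ 2 $ 1 = su11_b (\<lambda>k. G (int k) * z ^ k) k"
proof (induction k)
  case (Suc k)
  {
    case 1
    show ?case using Suc assms
      by (simp add: nlft_step_def matrix_matrix_mult_def sum_2 mat2_def powi_minus_unit norm_mult norm_power)
        (simp add: scaleR_conv_of_real add_divide_distrib algebra_simps)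
  next
    case 2
    show ?case using Suc assms
      by (simp add: nlft_step_def matrix_matrix_mult_def sum_2 mat2_def norm_mult norm_power)
        (simp add: scaleR_conv_of_real add_divide_distrib algebra_simps)
  }
qed (simp_all add: mat_def)

text \<open>\<open>supp_bound\<close> is an unspecified choice, but it does not affect the result:
  the factors at negative indices are identities, and past the support the column is constant. The
  indices 0 to \<open>N\<close> account for \<open>Suc N\<close>.\<close>

lemma nlft_trunc:
  assumes z: "norm z = 1" and F: "\<And>n. n < 0 \<Longrightarrow> F n = 0"
  shows "nlft_a z (trunc F N) = su11_a (\<lambda>k. F (int k) * z ^ k) (Suc N)"
    and "nlft_b z (trunc F N) = su11_b (\<lambda>k. F (int k) * z ^ k) (Suc N)"
proof -
  define G where "G = trunc F N"
  define S where "S = supp_bound G"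
  have "\<exists>M. 0 \<le> M \<and> (\<forall>n. G n \<noteq> 0 \<longrightarrow> \<bar>n\<bar> \<le> M)"
    by (rule exI[of _ "int N"]) (auto simp: G_def trunc_def)
  from someI_ex[OF this] have S: "0 \<le> S" "\<And>n. G n \<noteq> 0 \<Longrightarrow> \<bar>n\<bar> \<le> S"
    unfolding S_def supp_bound_def by auto
  define m where "m = nat S"
  have m: "S = int m" using S by (simp add: m_def)
  define g where "g k = G (int k) * z ^ k" for k
  have "nat (2 * S + 1) = m + Suc m" by (simp add: m)
  then have "nlft_matrix z G = nlft_transfer G z (- int m) (m + Suc m)"
    unfolding nlft_matrix_def S_def[symmetric] by (simp only: m)
  also have "\<dots> = nlft_transfer G z 0 (Suc m)"
    unfolding nlft_transfer_add using nlft_transfer_trivial[of m G "- int m" z]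
    by (simp add: G_def trunc_def F del: nlft_transfer.simps)
  finally have mat: "nlft_matrix z G = nlft_transfer G z 0 (Suc m)" .
  \<comment> \<open>The chosen bound may exceed \<open>N\<close>, or fall below it when
    \<open>F\<close> vanishes near \<open>N\<close>; both lengths are compared with the shorter
    one.\<close>
  define K where "K = min (Suc m) (Suc N)"
  have g0: "g k = 0" if "K \<le> k" for k
  proof (rule ccontr)
    assume "g k \<noteq> 0"
    then have "G (int k) \<noteq> 0" by (auto simp: g_def)
    then have "int k \<le> S" "int k \<le> int N" using S(2)[of "int k"] by (auto simp: G_def trunc_def split: if_splits)
    then show False using that by (simp add: K_def m)
  qed
  have gF: "g k = F (int k) * z ^ k" if "k < Suc N" for k
    using that by (simp add: g_def G_def trunc_def)
  have "su11_a g (Suc m) = su11_a g (Suc N)" "su11_b g (Suc m) = su11_b g (Suc N)"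
    using su11_eventually_zero[of K g, OF g0] by (metis K_def min.cobounded1 min.cobounded2)+
  then show "nlft_a z (trunc F N) = su11_a (\<lambda>k. F (int k) * z ^ k) (Suc N)"
    and "nlft_b z (trunc F N) = su11_b (\<lambda>k. F (int k) * z ^ k) (Suc N)"
    using su11_cong[of "Suc N" g "\<lambda>k. F (int k) * z ^ k", OF gF] nlft_transfer_column[OF z, of G "Suc m"]
    unfolding nlft_a_def nlft_b_def G_def[symmetric] mat g_def[symmetric] by (simp_all del: su11_a.simps su11_b.simps nlft_transfer.simps)
qed

section \<open>Oscillation of the glued sequence\<close>

lemma not_convergent_if_oscillating:
  fixes x :: "nat \<Rightarrow> complex"
  assumes "0 < c" and osc: "\<And>K. \<exists>m\<ge>K. \<exists>n\<ge>K. c \<le> norm (x m - x n)"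
  shows "\<not> (\<exists>L. (\<lambda>N. x (Suc N)) \<longlonglongrightarrow> L)"
proof
  assume "\<exists>L. (\<lambda>N. x (Suc N)) \<longlonglongrightarrow> L"
  then have "Cauchy x" by (auto simp: filterlim_sequentially_Suc intro: LIMSEQ_imp_Cauchy)
  then obtain K where "\<forall>m\<ge>K. \<forall>n\<ge>K. norm (x m - x n) < c"
    using CauchyD assms(1) by blast
  with osc[of K] show False by fastforce
qed

text \<open>Up to cross terms of size at most \<open>3/100\<close>, part of a block sends
  \<open>a\<close> to \<open>\<alpha> * a\<close> and \<open>b\<close> to
  \<open>cnj \<alpha> * b\<close>. Once \<alpha> is \<open>1/4\<close> away from 1, both have moved,
  because \<open>norm a \<ge> 1\<close> and \<open>norm b \<ge> 2/5\<close> at the start of every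
  block.\<close>

lemma glued_estimates:
  fixes f :: "nat \<Rightarrow> complex" and s L :: "nat \<Rightarrow> nat" and G :: "nat \<Rightarrow> nat \<Rightarrow> complex" and z :: complex
  defines "g \<equiv> \<lambda>k. f k * z ^ k" and "h \<equiv> \<lambda>j k. G j k * z ^ k"
  assumes z: "norm z = 1" and f1: "\<And>n. norm (f n) < 1" and f0: "f 0 = 1 / 2"
    and s0: "s 0 = 1" and s_Suc: "\<And>j. s (Suc j) = s j + L j"
    and fG: "\<And>j k. k < L j \<Longrightarrow> f (s j + k) = G j k"
    and G1: "\<And>j k. norm (G j k) < 1"
    and small: "\<And>j k. k \<le> L j \<Longrightarrow> norm (su11_b (h j) k) \<le> (1/2) ^ j / 50"
    and rot: "\<And>j. \<exists>k\<le>L j. 1 / 4 \<le> norm (su11_a (h j) k - 1)"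
  shows "\<exists>n\<ge>s j. 1 / 20 \<le> norm (su11_a g n - su11_a g (s j))"
    and "\<exists>n\<ge>s j. 1 / 20 \<le> norm (su11_b g n - su11_b g (s j))"
proof -
  define a b where "a j = su11_a g (s j)" and "b j = su11_b g (s j)" for j
  have g1: "\<And>k. norm (g k) < 1" using f1 z by (simp add: g_def norm_mult norm_power)
  have h1: "\<And>j k. norm (h j k) < 1" using G1 z by (simp add: h_def norm_mult norm_power)
  have gh: "g (s j + k) = z ^ s j * h j k" if "k < L j" for j k
    using fG[OF that] by (simp add: g_def h_def power_add)
  have zs: "norm (z ^ s j) = 1" for j using z by (simp add: norm_power)
  have concat:
    "su11_a g (s j + k) = su11_a (h j) k * a j + cnj (z ^ s j * su11_b (h j) k) * b j"
    "su11_b g (s j + k) = z ^ s j * su11_b (h j) k * a j + cnj (su11_a (h j) k) * b j"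
    if "k \<le> L j" for j k
    unfolding a_def b_def using su11_concat[of "L j" g "s j" "z ^ s j" "h j" k, OF gh zs that] by auto
  have a_ge: "1 \<le> norm (a j)" for j unfolding a_def by (rule su11_norm_a_ge_1[OF g1])
  have b_le_a: "norm (b j) \<le> norm (a j)" for j
  proof (rule power2_le_imp_le)
    show "(norm (b j))\<^sup>2 \<le> (norm (a j))\<^sup>2"
      unfolding a_def b_def su11_norm_sq[OF g1] by simp
  qed simp
  have a_Suc: "norm (a (Suc j)) \<le> norm (a j) + 2 * ((1/2) ^ j / 50) * norm (a j)" for j
  proof -
    have "norm (a (Suc j)) \<le> norm (su11_a (h j) (L j)) * norm (a j) + norm (su11_b (h j) (L j)) * norm (b j)"
      unfolding a_def[of "Suc j"] s_Suc concat(1)[OF order_refl]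
      by (rule order_trans[OF norm_triangle_ineq]) (simp add: norm_mult norm_power z)
    also have "\<dots> \<le> (1 + (1/2) ^ j / 50) * norm (a j) + (1/2) ^ j / 50 * norm (a j)"
      using su11_norm_a_le[of "h j" "L j", OF h1] small[of "L j" j] b_le_a[of j]
      by (intro add_mono mult_mono) auto
    finally show ?thesis by (simp add: algebra_simps)
  qed
  \<comment> \<open>As \<open>norm (su11_a (h j) (L j)) \<ge> 1\<close>, a block can shrink
    \<open>b\<close> only through its cross term.\<close>
  have b_Suc: "norm (b j) - (1/2) ^ j / 50 * norm (a j) \<le> norm (b (Suc j))" for j
  proof -
    have "1 * norm (b j) \<le> norm (su11_a (h j) (L j)) * norm (b j)"
      by (intro mult_right_mono su11_norm_a_ge_1 h1) auto
    also have "\<dots> = norm (cnj (su11_a (h j) (L j)) * b j)" by (simp add: norm_mult)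
    also have "\<dots> = norm (b (Suc j) - z ^ s j * su11_b (h j) (L j) * a j)"
      unfolding b_def[of "Suc j"] s_Suc concat(2)[OF order_refl] by simp
    also have "\<dots> \<le> norm (b (Suc j)) + norm (su11_b (h j) (L j)) * norm (a j)"
      by (rule order_trans[OF norm_triangle_ineq4]) (simp add: norm_mult norm_power z)
    also have "\<dots> \<le> norm (b (Suc j)) + (1/2) ^ j / 50 * norm (a j)"
      by (intro add_left_mono mult_right_mono small) auto
    finally show ?thesis by simp
  qed
  have sqrt34: "sqrt (3/4) = sqrt 3 / 2" by (simp add: real_sqrt_divide)
  have sqrt3: "17 / 10 \<le> sqrt 3" "sqrt 3 \<le> 18 / 10"
    by (rule real_le_rsqrt real_le_lsqrt; simp add: power2_eq_square)+
  have start: "norm (a 0) = 2 / sqrt 3" "norm (b 0) = 1 / sqrt 3"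
    by (simp_all add: a_def b_def s0 g_def f0 norm_divide power_divide sqrt34)
  \<comment> \<open>The subtracted term reserves room for later growth: with
    \<open>d = (1/2) ^ j\<close> it drops by \<open>d / 8\<close> in block \<open>j\<close>, where
    \<open>norm (a j)\<close> grows by at most \<open>3 * d / 50\<close>. In \<open>b_ge\<close> the
    same device sets \<open>d / 20\<close> against a loss of at most
    \<open>3 * d / 100\<close>.\<close>
  have a_le: "norm (a j) \<le> 3 / 2 - (1/2) ^ j / 4" for j
  proof (induction j)
    case 0
    show ?case using sqrt3 by (simp add: start field_simps)
  next
    case (Suc j)
    define d where "d = (1/2::real) ^ j"
    have "0 \<le> d" by (simp add: d_def)
    moreover have "norm (a j) \<le> 3 / 2"
      using Suc \<open>0 \<le> d\<close> unfolding d_def[symmetric] by linarith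
    then have "d / 50 * norm (a j) \<le> d / 50 * (3 / 2)"
      using \<open>0 \<le> d\<close> by (intro mult_left_mono) auto
    ultimately show ?case using a_Suc[of j] Suc unfolding power_Suc d_def[symmetric] by linarith
  qed
  have a_le': "norm (a j) \<le> 3 / 2" for j
    using a_le[of j] zero_le_power[of "1/2::real" j] by linarith
  have b_ge: "2 / 5 + (1/2) ^ j / 10 \<le> norm (b j)" for j
  proof (induction j)
    case 0
    show ?case using sqrt3 by (simp add: start field_simps)
  next
    case (Suc j)
    have "(1/2::real) ^ j / 50 * norm (a j) \<le> (1/2) ^ j / 50 * (3 / 2)"
      by (intro mult_left_mono a_le') auto
    moreover define d where "d = (1/2::real) ^ j"
    moreover have "0 \<le> d" by (simp add: d_def)
    ultimately show ?case using b_Suc[of j] Suc unfolding power_Suc d_def[symmetric] by linarith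
  qed
  have b_ge': "2 / 5 \<le> norm (b j)" for j
    using b_ge[of j] zero_le_power[of "1/2::real" j] by linarith
  have \<delta>: "(1/2::real) ^ j / 50 \<le> 1 / 50" for j
    by (simp add: power_le_one)
  obtain k where k: "k \<le> L j" "1 / 4 \<le> norm (su11_a (h j) k - 1)" using rot by blast
  define \<alpha> \<beta> where "\<alpha> = su11_a (h j) k" and "\<beta> = z ^ s j * su11_b (h j) k"
  have \<beta>: "norm \<beta> \<le> 1 / 50"
    using small[OF k(1)] \<delta>[of j] by (simp add: \<beta>_def norm_mult norm_power z)
  have \<alpha>: "1 / 4 \<le> norm (\<alpha> - 1)" using k by (simp add: \<alpha>_def)
  have "1 / 4 * 1 \<le> norm (\<alpha> - 1) * norm (a j)"
    using \<alpha> a_ge[of j] by (intro mult_mono) auto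
  also have "\<dots> = norm ((su11_a g (s j + k) - a j) - cnj \<beta> * b j)"
    unfolding concat(1)[OF k(1)] \<alpha>_def[symmetric] \<beta>_def[symmetric] norm_mult[symmetric]
    by (simp add: algebra_simps)
  also have "\<dots> \<le> norm (su11_a g (s j + k) - a j) + norm \<beta> * norm (b j)"
    by (rule order_trans[OF norm_triangle_ineq4]) (simp add: norm_mult)
  also have "norm \<beta> * norm (b j) \<le> 1 / 50 * (3 / 2)"
    using \<beta> b_le_a[of j] a_le'[of j] by (intro mult_mono) auto
  finally have "1 / 20 \<le> norm (su11_a g (s j + k) - a j)" by simp
  then show "\<exists>n\<ge>s j. 1 / 20 \<le> norm (su11_a g n - su11_a g (s j))"
    unfolding a_def using le_add1 by blast
  have "1 / 4 * (2 / 5) \<le> norm (cnj \<alpha> - 1) * norm (b j)"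
    using \<alpha> b_ge'[of j] complex_mod_cnj[of "\<alpha> - 1"] by (intro mult_mono) auto
  also have "\<dots> = norm ((su11_b g (s j + k) - b j) - \<beta> * a j)"
    unfolding concat(2)[OF k(1)] \<alpha>_def[symmetric] \<beta>_def[symmetric] norm_mult[symmetric]
    by (simp add: algebra_simps)
  also have "\<dots> \<le> norm (su11_b g (s j + k) - b j) + norm \<beta> * norm (a j)"
    by (rule order_trans[OF norm_triangle_ineq4]) (simp add: norm_mult)
  also have "norm \<beta> * norm (a j) \<le> 1 / 50 * (3 / 2)"
    using \<beta> a_le'[of j] by (intro mult_mono) auto
  finally have "1 / 20 \<le> norm (su11_b g (s j + k) - b j)" by simp
  then show "\<exists>n\<ge>s j. 1 / 20 \<le> norm (su11_b g n - su11_b g (s j))"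
    unfolding b_def using le_add1 by blast
qed

theorem theorem1p1:
  shows "\<exists>F :: int \<Rightarrow> complex.
     (\<forall>n. norm (F n) < 1) \<and>
     (\<lambda>n. (norm (F n))\<^sup>2) summable_on UNIV \<and>
     (\<forall>z. norm z = 1 \<longrightarrow>
        \<not> (\<exists>L. (\<lambda>N. nlft_a z (trunc F N)) \<longlonglongrightarrow> L) \<and>
        \<not> (\<exists>L. (\<lambda>N. nlft_b z (trunc F N)) \<longlonglongrightarrow> L))"
proof -
  \<comment> \<open>The tolerances form a geometric series, so the squared norms and the cross terms
    have bounded total over all blocks.\<close>
  define block where "block j L G \<longleftrightarrow> (\<forall>k. norm (G k) < 1) \<and> (\<Sum>k<L. (norm (G k))\<^sup>2) \<le> (1/2) ^ j / 50 \<and>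
      (\<forall>z. norm z = 1 \<longrightarrow> (\<forall>k\<le>L. norm (su11_b (\<lambda>k. G k * z ^ k) k) \<le> (1/2) ^ j / 50) \<and>
         (\<exists>k\<le>L. 1 / 4 \<le> norm (su11_a (\<lambda>k. G k * z ^ k) k - 1)))"
    for j L :: nat and G :: "nat \<Rightarrow> complex"
  have "\<forall>j. \<exists>LG. block j (fst LG) (snd LG)"
  proof
    fix j
    show "\<exists>LG. block j (fst LG) (snd LG)"
    proof (rule rotating_block[of "(1/2) ^ j / 50"])
      fix L :: nat and G :: "nat \<Rightarrow> complex"
      assume "\<And>k. norm (G k) < 1" "(\<Sum>k<L. (norm (G k))\<^sup>2) \<le> (1/2) ^ j / 50"
        "\<And>z k. norm z = 1 \<Longrightarrow> k \<le> L \<Longrightarrow> norm (su11_b (\<lambda>k. G k * z ^ k) k) \<le> (1/2) ^ j / 50"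
        "\<And>z. norm z = 1 \<Longrightarrow> \<exists>k\<le>L. 1 / 4 \<le> norm (su11_a (\<lambda>k. G k * z ^ k) k - 1)"
      then have "block j L G" unfolding block_def by blast
      then show ?thesis by (intro exI[of _ "(L, G)"]) simp
    qed simp
  qed
  then obtain LG where LG: "\<And>j. block j (fst (LG j)) (snd (LG j))" by metis
  define L G where "L j = fst (LG j)" and "G j = snd (LG j)" for j
  have blk: "block j (L j) (G j)" for j unfolding L_def G_def by (rule LG)
  \<comment> \<open>An empty block leaves \<open>su11_a\<close> equal to 1 and cannot rotate.
    Positive lengths make \<open>s\<close> strictly increasing.\<close>
  have L_pos: "0 < L j" for j
  proof -
    obtain k where "k \<le> L j" "1 / 4 \<le> norm (su11_a (\<lambda>k. G j k * 1 ^ k) k - 1)"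
      using blk[of j] unfolding block_def by (metis norm_one)
    then show ?thesis by (cases k) auto
  qed
  \<comment> \<open>The offset 1 keeps index 0 free for the coefficient \<open>1/2\<close>.\<close>
  define s where "s j = 1 + (\<Sum>i<j. L i)" for j
  have s_Suc: "s (Suc j) = s j + L j" for j by (simp add: s_def)
  have "strict_mono s" by (simp add: strict_mono_Suc_iff s_Suc L_pos)
  then have n_le_s: "n \<le> s n" for n by (rule strict_mono_imp_increasing)
  \<comment> \<open>The number of the block containing \<open>n\<close>, for
    \<open>n > 0\<close>.\<close>
  define J where "J n = (LEAST j. n < s (Suc j))" for n
  define f where "f n = (if n = 0 then 1 / 2 else G (J n) (n - s (J n)))" for n
  have fG: "f (s j + k) = G j k" if "k < L j" for j k
  proof -
    have "J (s j + k) = j" unfolding J_def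
    proof (rule Least_equality)
      show "s j + k < s (Suc j)" using that by (simp add: s_Suc)
      show "j \<le> i" if "s j + k < s (Suc i)" for i
      proof (rule ccontr)
        assume "\<not> j \<le> i"
        then have "s (Suc i) \<le> s j" using \<open>strict_mono s\<close> by (simp add: strict_mono_less_eq)
        with that show False by simp
      qed
    qed
    moreover have "s j \<noteq> 0" by (simp add: s_def)
    ultimately show ?thesis by (simp add: f_def)
  qed
  have f1: "norm (f n) < 1" for n
    using blk unfolding f_def block_def by (simp add: norm_divide)
  \<comment> \<open>\<open>29/100 = 1/4 + 1/25\<close> is the square of the coefficient
    \<open>1/2\<close> plus the allowances of all blocks; the subtracted term is the allowance not
    yet spent.\<close>
  have "(\<Sum>n<s j. (norm (f n))\<^sup>2) \<le> 29 / 100 - (1/2) ^ j / 25" for j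
  proof (induction j)
    case 0
    show ?case by (simp add: s_def f_def norm_divide power_divide)
  next
    case (Suc j)
    have "(\<Sum>n<s (Suc j). (norm (f n))\<^sup>2) = (\<Sum>n<s j. (norm (f n))\<^sup>2) + (\<Sum>k<L j. (norm (G j k))\<^sup>2)"
      unfolding s_Suc sum_lessThan_add by (simp add: fG)
    moreover have "(\<Sum>k<L j. (norm (G j k))\<^sup>2) \<le> (1/2) ^ j / 50" using blk[of j] by (simp add: block_def)
    moreover define d where "d = (1/2::real) ^ j"
    ultimately show ?case using Suc unfolding power_Suc d_def[symmetric] by linarith
  qed
  then have part: "(\<Sum>n<s j. (norm (f n))\<^sup>2) \<le> 1" for j
    by (rule order_trans) (use zero_le_power[of "1/2::real" j] in linarith)
  have "summable (\<lambda>n. (norm (f n))\<^sup>2)"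
  proof (rule summableI_nonneg_bounded)
    show "(\<Sum>k<n. (norm (f k))\<^sup>2) \<le> 1" for n
      using n_le_s[of n] by (intro order_trans[OF sum_mono2 part[of n]]) auto
  qed simp
  then have f_sum: "(\<lambda>n. (norm (f n))\<^sup>2) summable_on UNIV"
    by (simp add: summable_on_UNIV_nonneg_real_iff)
  \<comment> \<open>Vanishing at negative indices turns the symmetric truncations into one-sided
    partial products.\<close>
  define F :: "int \<Rightarrow> complex" where "F n = (if n < 0 then 0 else f (nat n))" for n
  have "(\<lambda>n. (norm (F n))\<^sup>2) summable_on range int"
    using f_sum by (subst summable_on_reindex) (auto simp: o_def F_def)
  then have F_sum: "(\<lambda>n. (norm (F n))\<^sup>2) summable_on UNIV"
  proof (rule summable_on_cong_neutral[THEN iffD1, rotated -1])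
    show "(norm (F n))\<^sup>2 = 0" if "n \<in> UNIV - range int" for n
      using that by (cases n rule: int_cases2) (auto simp: F_def)
  qed auto
  show ?thesis
  proof (intro exI[of _ F] conjI allI impI)
    show "norm (F n) < 1" for n using f1 by (simp add: F_def)
    show "(\<lambda>n. (norm (F n))\<^sup>2) summable_on UNIV" by (rule F_sum)
    fix z :: complex assume z: "norm z = 1"
    define g where "g k = f k * z ^ k" for k
    have Fg: "(\<lambda>k. F (int k) * z ^ k) = g" by (simp add: F_def g_def fun_eq_iff)
    have F0: "\<And>n. n < 0 \<Longrightarrow> F n = 0" by (simp add: F_def)
    have est: "\<exists>n\<ge>s j. 1 / 20 \<le> norm (su11_a g n - su11_a g (s j))"
      "\<exists>n\<ge>s j. 1 / 20 \<le> norm (su11_b g n - su11_b g (s j))" for j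
      using glued_estimates[of z f s L G j, OF z f1 _ _ s_Suc fG] blk z
      by (auto simp: f_def s_def block_def g_def[abs_def])
    have trunc: "nlft_a z (trunc F N) = su11_a g (Suc N)" "nlft_b z (trunc F N) = su11_b g (Suc N)" for N
      unfolding Fg[symmetric] by (rule nlft_trunc, rule z, simp add: F0)+
    show "\<not> (\<exists>L. (\<lambda>N. nlft_a z (trunc F N)) \<longlonglongrightarrow> L)"
      unfolding trunc
    proof (rule not_convergent_if_oscillating[of "1/20"])
      \<comment> \<open>Block \<open>K\<close> begins at \<open>s K \<ge> K\<close>, so its start
        and the time of its rotation both lie beyond \<open>K\<close>.\<close>
      show "\<exists>m\<ge>K. \<exists>n\<ge>K. 1 / 20 \<le> norm (su11_a g m - su11_a g n)" for K
        using est(1)[of K] n_le_s[of K] order_trans by blast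
    qed simp
    show "\<not> (\<exists>L. (\<lambda>N. nlft_b z (trunc F N)) \<longlonglongrightarrow> L)"
      unfolding trunc
    proof (rule not_convergent_if_oscillating[of "1/20"])
      show "\<exists>m\<ge>K. \<exists>n\<ge>K. 1 / 20 \<le> norm (su11_b g m - su11_b g n)" for K
        using est(2)[of K] n_le_s[of K] order_trans by blast
    qed simp
  qed
qed

end
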